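(* Let $\mathcal L$ be an $m$-cycle (the boundary of an $m$-gon, as a one-dimensional simplicial complex on $m$ vertices) for $m\ge5$. Then the double cohomology of $\mathcal Z_{\mathcal L}$ is $$\mathit{HH}^{-k,2\ell}(\mathcal Z_{\mathcal L})=\begin{cases}\mathbb Z,&(-k,2\ell)=(0,0),\ (-1,4),\ (-m+3,2(m-2)),\ (-m+2,2m);\\ 0,&\text{otherwise.}\end{cases}$$
   Context: For a simplicial complex $\mathcal K$ on the vertex set $[m]=\{1,\dots,m\}$ (containing $\varnothing$ and all singletons) and $I\subset[m]$, the full subcomplex is $\mathcal K_I=\{J\in\mathcal K: J\subset I\}$. All (co)homology has $\mathbb Z$ coefficients; $\widetilde H^*$ is reduced simplicial cohomology, with $\widetilde H^{-1}(\mathcal K_\varnothing)=\mathbb Z$. Moment-angle complex: $\mathcal Z_{\mathcal K}=\bigcup_{I\in\mathcal K}\{z\in(D^2)^m: |z_j|=1\text{ if }j\notin I\}$. Its cohomology has the bigraded Hochster decomposition $H^{-k,2\ell}(\mathcal Z_{\mathcal K})=\bigoplus_{I\subset[m],|I|=\ell}\widetilde H^{\ell-k-1}(\mathcal K_I)$, of total degree $-k+2\ell$. Double cohomology: for $i\in I$ let $\psi_{p;i,I}:\widetilde H^p(\mathcal K_I)\to\widetilde H^p(\mathcal K_{I\setminus\{i\}})$ be induced by inclusion, let $\varepsilon(i,I)=(-1)^{\#\{r\in I: r<i\}}$, and define $d'$ on $\widetilde H^p(\mathcal K_I)$ by $d'=(-1)^{p+1}\sum_{i\in I}\varepsilon(i,I)\psi_{p;i,I}$.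 Then $d':H^{-k,2\ell}(\mathcal Z_{\mathcal K})\to H^{-k+1,2\ell-2}(\mathcal Z_{\mathcal K})$, $(d')^2=0$, and $\mathit{HH}^{-k,2\ell}(\mathcal Z_{\mathcal K})$ denotes the cohomology of $(H^*(\mathcal Z_{\mathcal K}),d')$ at bidegree $(-k,2\ell)$. *)

theory Defs
  imports "HOL-Algebra.Product_Groups" "HOL-Algebra.FiniteProduct"
begin

section \<open>Simplicial complexes on the vertex set $[m]$\<close>

definition simplicial_complex_on :: "nat \<Rightarrow> nat set set \<Rightarrow> bool"
  where "simplicial_complex_on m K \<longleftrightarrow>
    K \<subseteq> Pow {1..m} \<and> {} \<in> K \<and> (\<forall>v\<in>{1..m}. {v} \<in> K) \<and> (\<forall>J\<in>K. \<forall>I\<subseteq>J. I \<in> K)"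

definition full_subcomplex :: "nat set set \<Rightarrow> nat set \<Rightarrow> nat set set"
  where "full_subcomplex K I = {J \<in> K. J \<subseteq> I}"

text \<open>The cyclic order \<open>v\<close> of the vertices around the polygon is arbitrary: it need not be the
  order \<open>1, \<dots>, m\<close> that is used for the signs below.\<close>

definition cycle_complex :: "nat \<Rightarrow> nat set set \<Rightarrow> bool"
  where "cycle_complex m L \<longleftrightarrow>
    (\<exists>v. bij_betw v {..<m} {1..m} \<and>
         L = {{}} \<union> {{v i} | i. i < m} \<union> {{v i, v (Suc i mod m)} | i. i < m})"

lemma simplicial_complex_on_cycle_complex:
  assumes "cycle_complex m L"
  shows "simplicial_complex_on m L"
proof -
  obtain v where v: "bij_betw v {..<m} {1..m}"
    and L: "L = {{}} \<union> {{v i} | i. i < m} \<union> {{v i, v (Suc i mod m)} | i. i < m}"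
    using assms unfolding cycle_complex_def by blast
  have im: "v ` {..<m} = {1..m}"
    using v by (simp add: bij_betw_def)
  have vm: "v i \<in> {1..m}" if "i < m" for i
    using that im by blast
  have md: "Suc i mod m < m" if "i < m" for i
    using that by simp
  have "L \<subseteq> Pow {1..m}"
    using vm md unfolding L by blast
  moreover have "\<forall>w\<in>{1..m}. {w} \<in> L"
    using im unfolding L by blast
  moreover have "I \<in> L" if "J \<in> L" "I \<subseteq> J" for I J
  proof -
    have vertex: "{} \<in> L" "{v i} \<in> L" if "i < m" for i
      using that unfolding L by blast+
    from \<open>J \<in> L\<close> consider "J = {}" | i where "i < m" "J = {v i}"
      | i where "i < m" "J = {v i, v (Suc i mod m)}"
      unfolding L by blast
    then show ?thesis
    proof cases
      case 1
      then show ?thesis using that by simp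
    next
      case (2 i)
      then have "I = {} \<or> I = {v i}"
        using that by blast
      then show ?thesis using vertex[OF \<open>i < m\<close>] by metis
    next
      case (3 i)
      then have "I = {} \<or> I = {v i} \<or> I = {v (Suc i mod m)} \<or> I = J"
        using that by blast
      then show ?thesis
        using vertex[OF \<open>i < m\<close>] vertex(2)[OF md[OF \<open>i < m\<close>]] that(1) by metis
    qed
  qed
  moreover have "{} \<in> L"
    unfolding L by blast
  ultimately show ?thesis
    unfolding simplicial_complex_on_def by blast
qed


section \<open>Reduced simplicial cohomology with integer coefficients\<close>

text \<open>Abelian groups are written multiplicatively, as elsewhere in \<open>HOL-Algebra\<close>.
  The cohomology at \<open>B\<close> of \<open>A \<rightarrow> B \<rightarrow> C\<close>, with maps \<open>f\<close> and \<open>g\<close>:\<close>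

definition cohomology_at ::
  "'a monoid \<Rightarrow> ('a \<Rightarrow> 'b) \<Rightarrow> 'b monoid \<Rightarrow> ('b \<Rightarrow> 'c) \<Rightarrow> 'c monoid \<Rightarrow> 'b set monoid"
  where "cohomology_at A f B g C = B\<lparr>carrier := kernel B C g\<rparr> Mod (f ` carrier A)"

text \<open>Dimensions are integers; the only simplex of dimension \<open>-1\<close> is the empty one, so the
  cochain complex below is the augmented one.\<close>

definition simplices :: "nat set set \<Rightarrow> int \<Rightarrow> nat set set"
  where "simplices K p = {J \<in> K. int (card J) = p + 1}"

definition cochain_group :: "nat set set \<Rightarrow> int \<Rightarrow> (nat set \<Rightarrow> int) monoid"
  where "cochain_group K p = product_group (simplices K p) (\<lambda>_. integer_group)"

definition eps :: "nat \<Rightarrow> nat set \<Rightarrow> int"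
  where "eps i I = (-1) ^ card {r \<in> I. r < i}"

definition coboundary :: "nat set set \<Rightarrow> int \<Rightarrow> (nat set \<Rightarrow> int) \<Rightarrow> nat set \<Rightarrow> int"
  where "coboundary K p f = (\<lambda>J\<in>simplices K (p + 1). \<Sum>j\<in>J. eps j J * f (J - {j}))"

definition reduced_cohomology :: "nat set set \<Rightarrow> int \<Rightarrow> (nat set \<Rightarrow> int) set monoid"
  where "reduced_cohomology K p =
    cohomology_at (cochain_group K (p - 1)) (coboundary K (p - 1))
      (cochain_group K p) (coboundary K p) (cochain_group K (p + 1))"

text \<open>The map in cohomology induced by the inclusion of a subcomplex \<open>L\<close> of \<open>K\<close>. A class is a
  coset \<open>c\<close> of the coboundaries of \<open>K\<close>; the restrictions to \<open>L\<close> of the cocycles in \<open>c\<close> may fill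
  only a part of a coset of the coboundaries of \<open>L\<close>, hence the set product.\<close>

definition cohomology_restriction ::
  "nat set set \<Rightarrow> int \<Rightarrow> (nat set \<Rightarrow> int) set \<Rightarrow> (nat set \<Rightarrow> int) set"
  where "cohomology_restriction L p c =
    coboundary L (p - 1) ` carrier (cochain_group L (p - 1))
      <#>\<^bsub>cochain_group L p\<^esub> (\<lambda>f. restrict f (simplices L p)) ` c"


section \<open>Double cohomology of the moment-angle complex\<close>

text \<open>\<open>ma_cohomology m K k l\<close> is $H^{-k,2l}(\mathcal{Z}_K)$ in its Hochster decomposition.\<close>

definition index_sets :: "nat \<Rightarrow> int \<Rightarrow> nat set set"
  where "index_sets m l = {I. I \<subseteq> {1..m} \<and> int (card I) = l}"

definition ma_cohomology ::
  "nat \<Rightarrow> nat set set \<Rightarrow> int \<Rightarrow> int \<Rightarrow> (nat set \<Rightarrow> (nat set \<Rightarrow> int) set) monoid"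
  where "ma_cohomology m K k l =
    sum_group (index_sets m l) (\<lambda>I. reduced_cohomology (full_subcomplex K I) (l - k - 1))"

text \<open>\<open>d'\<close> from bidegree \<open>(-k, 2l)\<close> to \<open>(-k + 1, 2l - 2)\<close>, given by its components: the summand of
  \<open>J\<close> receives $(-1)^{p+1}\varepsilon(i,I)\psi_{p;i,I}$ from those \<open>I\<close> with \<open>I - {i} = J\<close>, that is, from
  \<open>I = insert i J\<close> for \<open>i \<notin> J\<close>. The use of \<open>nat\<close> is harmless since the groups vanish for
  \<open>p < -1\<close>.\<close>

definition double_differential ::
  "nat \<Rightarrow> nat set set \<Rightarrow> int \<Rightarrow> int \<Rightarrow>
    (nat set \<Rightarrow> (nat set \<Rightarrow> int) set) \<Rightarrow> nat set \<Rightarrow> (nat set \<Rightarrow> int) set"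
  where "double_differential m K k l x =
    (let p = l - k - 1 in
     (\<lambda>J\<in>index_sets m (l - 1).
       \<Otimes>\<^bsub>reduced_cohomology (full_subcomplex K J) p\<^esub>i\<in>{1..m} - J.
         cohomology_restriction (full_subcomplex K J) p (x (insert i J))
           [^]\<^bsub>reduced_cohomology (full_subcomplex K J) p\<^esub>
         ((-1) ^ nat (p + 1) * eps i (insert i J))))"

text \<open>\<open>HH m K k l\<close> is $\mathit{HH}^{-k,2l}(\mathcal{Z}_K)$.\<close>

definition HH ::
  "nat \<Rightarrow> nat set set \<Rightarrow> int \<Rightarrow> int \<Rightarrow> (nat set \<Rightarrow> (nat set \<Rightarrow> int) set) set monoid"
  where "HH m K k l =
    cohomology_at
      (ma_cohomology m K (k + 1) (l + 1)) (double_differential m K (k + 1) (l + 1))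
      (ma_cohomology m K k l) (double_differential m K k l)
      (ma_cohomology m K (k - 1) (l - 1))"

end

theory Submission
  imports Defs "HOL-Library.Function_Algebras"
begin

text \<open>
  The differential \<open>d'\<close> keeps the cohomological degree \<open>p = l - k - 1\<close>, so for each \<open>p\<close> the double
  cohomology is the homology of the complex whose term in degree \<open>l\<close> is the sum of the groups
  \<open>H~\<^sup>p(K\<^sub>I)\<close> with \<open>|I| = l\<close>. Each of these groups is in turn the cohomology of a cochain complex, so
  there is a double complex behind it: families \<open>F I J\<close> of integers, with \<open>J\<close> a \<open>p\<close>-simplex of
  \<open>K\<^sub>I\<close>, a simplicial coboundary \<open>Delta\<close> that acts on \<open>J\<close>, and a differential \<open>cube_diff\<close> that acts on
  \<open>I\<close>. For a fixed \<open>J\<close> the sets \<open>I\<close> that contain \<open>J\<close> form a cube whose coordinates are the vertices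
  outside \<open>J\<close>. As soon as no simplex contains all vertices, this cube has positive dimension and
  its complex is contractible (\<open>cube_exact\<close>). So the spectral sequence of the double complex
  converges to zero, and the double cohomology is the second page of it.

  For the \<open>m\<close>-gon, \<open>H~\<^sup>-\<^sup>1(K\<^sub>I)\<close> is nonzero only for the empty \<open>I\<close>, and \<open>H~\<^sup>1(K\<^sub>I)\<close> only for \<open>I = [m]\<close>;
  both are infinite cyclic. They are alone in their rows and give the classes in bidegrees \<open>(0, 0)\<close>
  and \<open>(-m + 2, 2m)\<close>. The only other row is \<open>p = 0\<close>, and the only
  possible higher differentials are the transgressions from \<open>p\<close> to \<open>p - 1\<close>, which lower \<open>l\<close> by two:
  from \<open>(p, l) = (0, 2)\<close> to \<open>(-1, 0)\<close> and from \<open>(1, m)\<close> to \<open>(0, m - 2)\<close>. Since everything has to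
  cancel, row \<open>0\<close> has an infinite cyclic group for \<open>l = 2\<close> and for \<open>l = m - 2\<close> and nothing else.
  The hypothesis \<open>m \<ge> 5\<close> separates these two places; for \<open>m = 4\<close> they coincide.

  The spectral sequence is replaced by explicit diagram chases. A class of row \<open>0\<close> is a family \<open>F\<close>
  of locally constant functions with \<open>cube_diff F = Delta C\<close>. The obstruction to moving it to the
  row of edges is \<open>cube_diff C\<close>, which is an integer for \<open>l = 2\<close> (\<open>pair_transgression\<close>) and vanishes
  otherwise (\<open>closed_on_empty\<close>, \<open>descend\<close>). The obstruction to bounding it there is a class in
  \<open>H~\<^sup>1(K\<^sub>I)\<close> with \<open>|I| = l + 2\<close>, which amounts to an integer for \<open>l = m - 2\<close> (\<open>top_transgression\<close>) and
  vanishes otherwise (\<open>proper_edge_exact\<close>, \<open>correct_below_top\<close>).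

  All groups involved are quotients of groups of cochains. The locale \<open>presented_group\<close> records
  such a description, and \<open>presented_group_HH\<close> gives it for the double cohomology; after that, only
  integer-valued functions occur.
\<close>

section \<open>Abelian groups presented as quotients\<close>

text \<open>The abelian group \<open>G\<close> is \<open>Z / B\<close> by way of the quotient map \<open>q\<close>, where \<open>Z\<close> and \<open>B\<close> are
  subgroups of an additively written type. The map \<open>q\<close> is total, but it is constrained on \<open>Z\<close> only;
  this lets cochains be arbitrary functions whose values off the relevant simplices are ignored.\<close>
locale presented_group =
  fixes Z B :: "'c::ab_group_add set" and q :: "'c \<Rightarrow> 'g" and G :: "'g monoid"
  assumes comm_group: "comm_group G"
    and zero: "0 \<in> Z"
    and diff: "\<And>x y. x \<in> Z \<Longrightarrow> y \<in> Z \<Longrightarrow> x - y \<in> Z"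
    and onto: "q ` Z = carrier G"
    and hom_add: "\<And>x y. x \<in> Z \<Longrightarrow> y \<in> Z \<Longrightarrow> q (x + y) = q x \<otimes>\<^bsub>G\<^esub> q y"
    and eq_one_iff: "\<And>x. x \<in> Z \<Longrightarrow> q x = \<one>\<^bsub>G\<^esub> \<longleftrightarrow> x \<in> B"
    and relators: "B \<subseteq> Z"
begin

sublocale G: comm_group G
  by (rule comm_group)

lemma neg: "x \<in> Z \<Longrightarrow> - x \<in> Z"
  using diff[OF zero] by fastforce

lemma add: "x \<in> Z \<Longrightarrow> y \<in> Z \<Longrightarrow> x + y \<in> Z"
  using diff[of x "- y"] neg by fastforce

lemma closed: "x \<in> Z \<Longrightarrow> q x \<in> carrier G"
  using onto by blast

lemma hom_zero: "q 0 = \<one>\<^bsub>G\<^esub>"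
  using hom_add[OF zero zero] closed[OF zero] by (simp add: G.l_cancel_one)

lemma hom_neg:
  assumes "x \<in> Z"
  shows "q (- x) = inv\<^bsub>G\<^esub> q x"
proof -
  have "q (- x) \<otimes>\<^bsub>G\<^esub> q x = \<one>\<^bsub>G\<^esub>"
    using hom_add[OF neg[OF assms] assms] hom_zero by simp
  then show ?thesis
    using G.inv_equality closed assms neg by metis
qed

lemma hom_diff: "x \<in> Z \<Longrightarrow> y \<in> Z \<Longrightarrow> q (x - y) = q x \<otimes>\<^bsub>G\<^esub> inv\<^bsub>G\<^esub> q y"
  using hom_add[of x "- y"] hom_neg neg by simp

lemma eq_iff:
  assumes "x \<in> Z" "y \<in> Z"
  shows "q x = q y \<longleftrightarrow> x - y \<in> B"
proof -
  have "x - y \<in> B \<longleftrightarrow> q x \<otimes>\<^bsub>G\<^esub> inv\<^bsub>G\<^esub> q y = \<one>\<^bsub>G\<^esub>"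
    using eq_one_iff[OF diff[OF assms]] hom_diff[OF assms] by simp
  also have "\<dots> \<longleftrightarrow> q x = q y"
    using closed assms by (metis G.inv_closed G.inv_equality G.inv_inv G.r_inv)
  finally show ?thesis by simp
qed

lemma hom_sum:
  assumes "finite X" "\<And>i. i \<in> X \<Longrightarrow> f i \<in> Z"
  shows "(\<Otimes>\<^bsub>G\<^esub>i\<in>X. q (f i)) = q (\<Sum>i\<in>X. f i) \<and> (\<Sum>i\<in>X. f i) \<in> Z"
  using assms
proof (induction X rule: finite_induct)
  case empty
  then show ?case by (simp add: hom_zero zero)
next
  case (insert i X)
  then show ?case
    by (simp add: Pi_iff closed hom_add add G.finprod_insert)
qed

end

text \<open>Passing to cohomology keeps presentations: if the two maps of \<open>A \<rightarrow> G \<rightarrow> C\<close> lift to additive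
  maps \<open>\<phi>\<close> and \<open>\<gamma>\<close> of the presenting groups, then the cycles are the \<open>y\<close> with \<open>\<gamma> y\<close> a relator, and
  the new relators are the values of \<open>\<phi>\<close> up to old relators. This is used twice, for the cochain
  complex of a simplicial complex and for the complex with differential \<open>d'\<close>.\<close>
lemma presented_group_cohomology_at:
  assumes "presented_group Z1 B1 q1 A" "presented_group Z2 B2 q2 G" "presented_group Z3 B3 q3 C"
    and \<phi>: "\<And>x. x \<in> Z1 \<Longrightarrow> \<phi> x \<in> Z2" "\<And>x y. \<phi> (x + y) = \<phi> x + \<phi> y"
    and \<gamma>: "\<And>y. y \<in> Z2 \<Longrightarrow> \<gamma> y \<in> Z3" "\<And>x y. \<gamma> (x + y) = \<gamma> x + \<gamma> y"
    and f: "\<And>x. x \<in> Z1 \<Longrightarrow> f (q1 x) = q2 (\<phi> x)"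
    and g: "\<And>y. y \<in> Z2 \<Longrightarrow> g (q2 y) = q3 (\<gamma> y)"
    and complex: "\<And>x. x \<in> Z1 \<Longrightarrow> \<gamma> (\<phi> x) \<in> B3"
  shows "presented_group {y \<in> Z2. \<gamma> y \<in> B3} {y \<in> Z2. \<exists>x\<in>Z1. y - \<phi> x \<in> B2}
    (\<lambda>y. f ` carrier A #>\<^bsub>G\<^esub> q2 y) (cohomology_at A f G g C)"
proof -
  interpret A: presented_group Z1 B1 q1 A by fact
  interpret G: presented_group Z2 B2 q2 G by fact
  interpret C: presented_group Z3 B3 q3 C by fact
  have hom_f: "f \<in> hom A G"
  proof (rule homI)
    fix a assume "a \<in> carrier A"
    then obtain x where "x \<in> Z1" "a = q1 x" using A.onto by blast
    then show "f a \<in> carrier G" using f \<phi> G.closed by metis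
  next
    fix a b assume "a \<in> carrier A" "b \<in> carrier A"
    then obtain x y where "x \<in> Z1" "a = q1 x" "y \<in> Z1" "b = q1 y" using A.onto by blast
    then show "f (a \<otimes>\<^bsub>A\<^esub> b) = f a \<otimes>\<^bsub>G\<^esub> f b"
      using f \<phi> A.hom_add G.hom_add A.add by metis
  qed
  have hom_g: "g \<in> hom G C"
  proof (rule homI)
    fix a assume "a \<in> carrier G"
    then obtain x where "x \<in> Z2" "a = q2 x" using G.onto by blast
    then show "g a \<in> carrier C" using g \<gamma> C.closed by metis
  next
    fix a b assume "a \<in> carrier G" "b \<in> carrier G"
    then obtain x y where "x \<in> Z2" "a = q2 x" "y \<in> Z2" "b = q2 y" using G.onto by blast
    then show "g (a \<otimes>\<^bsub>G\<^esub> b) = g a \<otimes>\<^bsub>C\<^esub> g b"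
      using g \<gamma> G.hom_add C.hom_add G.add by metis
  qed
  interpret f: group_hom A G f
    using hom_f by unfold_locales
  interpret g: group_hom G C g
    using hom_g by unfold_locales
  define N where "N = f ` carrier A"
  define K where "K = G\<lparr>carrier := kernel G C g\<rparr>"
  have kernel: "kernel G C g = q2 ` {y \<in> Z2. \<gamma> y \<in> B3}"
    unfolding kernel_def G.onto[symmetric] using g \<gamma>(1) C.eq_one_iff by auto
  have N_kernel: "N \<subseteq> kernel G C g"
  proof
    fix b assume "b \<in> N"
    then obtain x where "x \<in> Z1" "b = q2 (\<phi> x)"
      unfolding N_def using A.onto f by (metis imageE)
    then show "b \<in> kernel G C g"
      unfolding kernel using complex \<phi> by blast
  qed
  interpret K: comm_group K
    unfolding K_def using G.G.subgroup_imp_group[OF g.subgroup_kernel]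
    by (intro group.group_comm_groupI) (auto simp: kernel_def G.G.m_comm)
  have N_sub: "subgroup N K"
    unfolding K_def using G.G.subgroup_incl[OF _ g.subgroup_kernel N_kernel] f.img_is_subgroup
    by (simp add: N_def)
  then interpret N: normal N K
    by (rule K.subgroup_imp_normal)
  have coh: "cohomology_at A f G g C = K Mod N"
    by (simp add: cohomology_at_def K_def N_def)
  have r_coset: "N #>\<^bsub>G\<^esub> b = N #>\<^bsub>K\<^esub> b" for b
    by (simp add: r_coset_def K_def)
  have q2K: "q2 y \<in> carrier K" if "y \<in> Z2" "\<gamma> y \<in> B3" for y
    using that kernel by (auto simp: K_def)
  have \<gamma>0: "\<gamma> 0 = 0"
    using \<gamma>(2)[of 0 0] by simp
  have \<gamma>diff: "\<gamma> (x - y) = \<gamma> x - \<gamma> y" for x y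
    using \<gamma>(2)[of "x - y" y] by simp
  have B3: "x - y \<in> B3" if "x \<in> B3" "y \<in> B3" for x y
    using that C.relators C.eq_iff[of x y] C.eq_one_iff[of x] C.eq_one_iff[of y] by auto
  have "0 \<in> B3"
    using C.eq_one_iff[OF C.zero] C.hom_zero by simp
  show ?thesis
    unfolding coh N_def[symmetric] r_coset
  proof (rule presented_group.intro)
    show "comm_group (K Mod N)"
      using K.abelian_FactGroup[OF N_sub] .
    show "0 \<in> {y \<in> Z2. \<gamma> y \<in> B3}"
      using G.zero \<gamma>0 \<open>0 \<in> B3\<close> by simp
    show "x - y \<in> {y \<in> Z2. \<gamma> y \<in> B3}"
      if "x \<in> {y \<in> Z2. \<gamma> y \<in> B3}" "y \<in> {y \<in> Z2. \<gamma> y \<in> B3}" for x y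
      using that by (simp add: \<gamma>diff B3 G.diff)
    show "(\<lambda>y. N #>\<^bsub>K\<^esub> q2 y) ` {y \<in> Z2. \<gamma> y \<in> B3} = carrier (K Mod N)"
      unfolding carrier_FactGroup by (simp add: K_def kernel image_image)
    show "N #>\<^bsub>K\<^esub> q2 (x + y) = (N #>\<^bsub>K\<^esub> q2 x) \<otimes>\<^bsub>K Mod N\<^esub> (N #>\<^bsub>K\<^esub> q2 y)"
      if "x \<in> {y \<in> Z2. \<gamma> y \<in> B3}" "y \<in> {y \<in> Z2. \<gamma> y \<in> B3}" for x y
      using that N.rcos_sum[OF q2K q2K] by (simp add: G.hom_add, simp add: K_def)
    show "N #>\<^bsub>K\<^esub> q2 x = \<one>\<^bsub>K Mod N\<^esub> \<longleftrightarrow> x \<in> {y \<in> Z2. \<exists>x\<in>Z1. y - \<phi> x \<in> B2}"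
      if x: "x \<in> {y \<in> Z2. \<gamma> y \<in> B3}" for x
    proof -
      have "N #>\<^bsub>K\<^esub> q2 x = \<one>\<^bsub>K Mod N\<^esub> \<longleftrightarrow> q2 x \<in> N"
        using x q2K[of x] K.coset_join1[OF _ _ N_sub] K.coset_join2[OF _ N_sub] N.subset
        by (auto simp: FactGroup_def)
      also have "\<dots> \<longleftrightarrow> (\<exists>z\<in>Z1. q2 x = q2 (\<phi> z))"
        unfolding N_def A.onto[symmetric] by (auto simp: image_iff f)
      also have "\<dots> \<longleftrightarrow> (\<exists>z\<in>Z1. x - \<phi> z \<in> B2)"
        using G.eq_iff x \<phi>(1) by auto
      finally show ?thesis
        using x by simp
    qed
    show "{y \<in> Z2. \<exists>x\<in>Z1. y - \<phi> x \<in> B2} \<subseteq> {y \<in> Z2. \<gamma> y \<in> B3}"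
    proof clarify
      fix y x assume y: "y \<in> Z2" "x \<in> Z1" "y - \<phi> x \<in> B2"
      then have "q2 y = q2 (\<phi> x)"
        using G.eq_iff \<phi>(1) by simp
      then have "q2 y \<in> kernel G C g"
        unfolding kernel using y \<phi>(1) complex by blast
      then have "g (q2 y) = \<one>\<^bsub>C\<^esub>"
        by (simp add: kernel_def)
      then show "\<gamma> y \<in> B3"
        using g[OF y(1)] C.eq_one_iff \<gamma>(1) y(1) by simp
    qed
  qed
qed

lemma presented_group_sum_group:
  fixes Z B :: "'i \<Rightarrow> 'c::ab_group_add set"
  assumes X: "finite X" and G: "\<And>i. i \<in> X \<Longrightarrow> presented_group (Z i) (B i) (q i) (G i)"
  shows "presented_group {F. \<forall>i\<in>X. F i \<in> Z i} {F. \<forall>i\<in>X. F i \<in> B i}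
    (\<lambda>F. \<lambda>i\<in>X. q i (F i)) (sum_group X G)"
proof -
  have grp: "group (G i)" "comm_group (G i)" if "i \<in> X" for i
    using presented_group.comm_group[OF G[OF that]] by (simp_all add: comm_group_def)
  have carrier: "carrier (sum_group X G) = (\<Pi>\<^sub>E i\<in>X. carrier (G i))"
    using X grp by (subst carrier_sum_group) auto
  have comm: "comm_group (sum_group X G)"
  proof (rule group.group_comm_groupI)
    show "group (sum_group X G)" using grp by simp
    fix x y assume "x \<in> carrier (sum_group X G)" "y \<in> carrier (sum_group X G)"
    then show "x \<otimes>\<^bsub>sum_group X G\<^esub> y = y \<otimes>\<^bsub>sum_group X G\<^esub> x"
      unfolding carrier using grp
      by (auto simp: PiE_iff comm_groupE(4) intro!: restrict_ext)
  qed
  show ?thesis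
  proof (rule presented_group.intro[OF comm])
    show "0 \<in> {F. \<forall>i\<in>X. F i \<in> Z i}"
      using presented_group.zero[OF G] by simp
    show "x - y \<in> {F. \<forall>i\<in>X. F i \<in> Z i}"
      if "x \<in> {F. \<forall>i\<in>X. F i \<in> Z i}" "y \<in> {F. \<forall>i\<in>X. F i \<in> Z i}" for x y
      using that presented_group.diff[OF G] by simp
    show "(\<lambda>F. \<lambda>i\<in>X. q i (F i)) ` {F. \<forall>i\<in>X. F i \<in> Z i} = carrier (sum_group X G)"
    proof (rule equalityI; rule subsetI)
      fix x assume "x \<in> (\<lambda>F. \<lambda>i\<in>X. q i (F i)) ` {F. \<forall>i\<in>X. F i \<in> Z i}"
      then show "x \<in> carrier (sum_group X G)"
        unfolding carrier using presented_group.closed[OF G] by auto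
    next
      fix x assume x: "x \<in> carrier (sum_group X G)"
      have "\<forall>i\<in>X. \<exists>z. z \<in> Z i \<and> q i z = x i"
      proof
        fix i assume "i \<in> X"
        then have "x i \<in> carrier (G i)" using x carrier by auto
        then show "\<exists>z. z \<in> Z i \<and> q i z = x i"
          unfolding presented_group.onto[OF G[OF \<open>i \<in> X\<close>], symmetric] by auto
      qed
      then obtain F where F: "\<forall>i\<in>X. F i \<in> Z i \<and> q i (F i) = x i"
        by metis
      then have "x = (\<lambda>i\<in>X. q i (F i))"
        using x unfolding carrier by (auto simp: fun_eq_iff PiE_iff extensional_def)
      with F show "x \<in> (\<lambda>F. \<lambda>i\<in>X. q i (F i)) ` {F. \<forall>i\<in>X. F i \<in> Z i}"
        by blast
    qed
    show "(\<lambda>i\<in>X. q i ((x + y) i)) = (\<lambda>i\<in>X. q i (x i)) \<otimes>\<^bsub>sum_group X G\<^esub> (\<lambda>i\<in>X. q i (y i))"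
      if "x \<in> {F. \<forall>i\<in>X. F i \<in> Z i}" "y \<in> {F. \<forall>i\<in>X. F i \<in> Z i}" for x y
      using that presented_group.hom_add[OF G] by (auto intro!: restrict_ext)
    show "(\<lambda>i\<in>X. q i (x i)) = \<one>\<^bsub>sum_group X G\<^esub> \<longleftrightarrow> x \<in> {F. \<forall>i\<in>X. F i \<in> B i}"
      if "x \<in> {F. \<forall>i\<in>X. F i \<in> Z i}" for x
    proof -
      have "(\<lambda>i\<in>X. q i (x i)) = \<one>\<^bsub>sum_group X G\<^esub> \<longleftrightarrow> (\<forall>i\<in>X. q i (x i) = \<one>\<^bsub>G i\<^esub>)"
        by (auto simp: fun_eq_iff restrict_def)
      then show ?thesis
        using that presented_group.eq_one_iff[OF G] by simp
    qed
    show "{F. \<forall>i\<in>X. F i \<in> B i} \<subseteq> {F. \<forall>i\<in>X. F i \<in> Z i}"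
      using presented_group.relators[OF G] by blast
  qed
qed

lemma (in presented_group) trivial_groupI:
  assumes "Z \<subseteq> B"
  shows "trivial_group G"
proof -
  have "carrier G = {\<one>\<^bsub>G\<^esub>}"
    unfolding onto[symmetric] using assms eq_one_iff zero hom_zero
    by (auto simp: image_iff subset_iff intro!: bexI[of _ 0])
  then show ?thesis
    by (simp add: trivial_group_def G.is_group)
qed

text \<open>To compute \<open>G\<close> it is enough to parametrize its elements, up to relators, by an additive group
  \<open>T\<close> on which the wanted isomorphism is given by an explicit formula \<open>\<Phi>\<close>: then \<open>G\<close> and the integers
  are both the quotient of \<open>T\<close> by the common kernel. A parametrization \<open>\<theta>\<close> by something other than
  \<open>Z\<close> serves when \<open>\<Phi>\<close> is additive only on data from which the cocycle is built.\<close>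
lemma (in presented_group) iso_integer_groupI:
  fixes T :: "'t::ab_group_add set" and \<theta> :: "'t \<Rightarrow> 'c" and \<Phi> :: "'t \<Rightarrow> int"
  assumes T: "0 \<in> T" "\<And>x y. x \<in> T \<Longrightarrow> y \<in> T \<Longrightarrow> x - y \<in> T"
    and \<theta>: "\<And>x. x \<in> T \<Longrightarrow> \<theta> x \<in> Z" "\<And>x y. \<theta> (x + y) = \<theta> x + \<theta> y"
    and \<Phi>: "\<And>x y. \<Phi> (x + y) = \<Phi> x + \<Phi> y"
    and \<theta>_onto: "\<And>z. z \<in> Z \<Longrightarrow> \<exists>x\<in>T. z - \<theta> x \<in> B"
    and \<Phi>_onto: "\<exists>x\<in>T. \<Phi> x = 1"
    and kernels: "\<And>x. x \<in> T \<Longrightarrow> \<theta> x \<in> B \<longleftrightarrow> \<Phi> x = 0"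
  shows "G \<cong> integer_group"
proof -
  have Tneg: "- x \<in> T" if "x \<in> T" for x
    using T that by fastforce
  have Tadd: "x + y \<in> T" if "x \<in> T" "y \<in> T" for x y
    using T(2)[OF that(1) Tneg[OF that(2)]] by simp
  define A where "A = \<lparr>carrier = T, monoid.mult = (+), one = (0::'t)\<rparr>"
  have A: "group A"
    by (rule groupI) (auto simp: A_def T Tadd algebra_simps intro: bexI[of _ "- _"] Tneg)
  have \<theta>A: "q \<circ> \<theta> \<in> hom A G"
    by (rule homI) (auto simp: A_def closed \<theta> hom_add)
  have \<Phi>A: "\<Phi> \<in> hom A integer_group"
    by (rule homI) (auto simp: A_def \<Phi>)
  have "\<exists>x\<in>T. \<Phi> x = int n" for n
  proof (induction n)
    case 0
    have "\<Phi> 0 = 0" using \<Phi>[of 0 0] by simp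
    then show ?case using T by force
  next
    case (Suc n)
    then show ?case using \<Phi>_onto Tadd \<Phi> by (metis of_nat_Suc)
  qed
  moreover have "\<Phi> (- x) = - \<Phi> x" for x
    using \<Phi>[of x "- x"] \<Phi>[of 0 0] by simp
  ultimately have "\<exists>x\<in>T. \<Phi> x = k" for k
    using Tneg by (cases k rule: int_cases2) metis+
  then have \<Phi>surj: "\<Phi> ` carrier A = carrier integer_group"
    by (auto simp: A_def image_iff) metis
  have \<theta>surj: "(q \<circ> \<theta>) ` carrier A = carrier G"
  proof (rule equalityI; rule subsetI)
    fix g assume "g \<in> carrier G"
    then obtain z where z: "z \<in> Z" "g = q z" using onto by blast
    then obtain x where "x \<in> T" "z - \<theta> x \<in> B" using \<theta>_onto by blast
    then have "g = q (\<theta> x)" using z eq_iff \<theta>(1) by simp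
    then show "g \<in> (q \<circ> \<theta>) ` carrier A" using \<open>x \<in> T\<close> by (simp add: A_def)
  qed (use \<theta>A in \<open>auto simp: hom_def\<close>)
  interpret \<Theta>: group_hom A G "q \<circ> \<theta>"
    using A \<theta>A by (simp add: group_hom_def group_hom_axioms_def G.is_group)
  interpret \<Phi>: group_hom A integer_group \<Phi>
    using A \<Phi>A by (simp add: group_hom_def group_hom_axioms_def)
  have "kernel A G (q \<circ> \<theta>) = kernel A integer_group \<Phi>"
    using \<theta>(1) eq_one_iff kernels by (auto simp: kernel_def A_def)
  moreover have "A Mod kernel A G (q \<circ> \<theta>) \<cong> G"
    using \<Theta>.FactGroup_iso[OF \<theta>surj] .
  moreover have "A Mod kernel A integer_group \<Phi> \<cong> integer_group"
    using \<Phi>.FactGroup_iso[OF \<Phi>surj] .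
  moreover have "group (A Mod kernel A G (q \<circ> \<theta>))"
    using normal.factorgroup_is_group \<Theta>.normal_kernel .
  ultimately show ?thesis
    using iso_trans group.iso_sym by metis
qed

section \<open>Signs and the simplicial coboundary\<close>
lemma sum_fun_apply: "(\<Sum>i\<in>X. f i) x = (\<Sum>i\<in>X. f i x)"
  by (induction X rule: infinite_finite_induct) simp_all

lemma sign_cases: "(- 1 :: int) ^ n = 1 \<or> (- 1 :: int) ^ n = - 1"
  by (cases "even n") simp_all

lemma eps_sign: "eps i I = 1 \<or> eps i I = - 1"
  unfolding eps_def by (rule sign_cases)

text \<open>Deleting the smaller of two elements shifts the position of the larger one by one, and not
  conversely. This is the reason why both differentials of the double complex square to zero.\<close>
lemma eps_exchange:
  assumes "finite J" "i \<in> J" "j \<in> J" "i \<noteq> j"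
  shows "eps i J * eps j (J - {i}) = - (eps j J * eps i (J - {j}))"
proof -
  have *: "eps i J * eps j (J - {i}) = - (eps j J * eps i (J - {j}))"
    if "i \<in> J" "i < j" for i j
  proof -
    have "{r \<in> J - {i}. r < j} = {r \<in> J. r < j} - {i}" "{r \<in> J - {j}. r < i} = {r \<in> J. r < i}"
      using that by auto
    moreover have "card {r \<in> J. r < j} = Suc (card ({r \<in> J. r < j} - {i}))"
      using that assms(1) by (subst card.remove[of _ i]) auto
    ultimately show ?thesis
      by (simp add: eps_def)
  qed
  show ?thesis
    using *[of i j] *[of j i] assms by (cases "i < j") auto
qed

lemma antisymmetric_sum_zero:
  fixes a :: "'i \<Rightarrow> 'i \<Rightarrow> int"
  assumes "finite X" "\<And>i j. i \<in> X \<Longrightarrow> j \<in> X \<Longrightarrow> i \<noteq> j \<Longrightarrow> a i j = - a j i"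
  shows "(\<Sum>i\<in>X. \<Sum>j\<in>X - {i}. a i j) = 0"
proof -
  define b where "b i j = (if j = i then 0 else a i j)" for i j
  have "(\<Sum>j\<in>X - {i}. a i j) = (\<Sum>j\<in>X. b i j)" if "i \<in> X" for i
  proof -
    have "(\<Sum>j\<in>X. b i j) = b i i + (\<Sum>j\<in>X - {i}. b i j)"
      using assms(1) that by (rule sum.remove)
    also have "b i i = 0"
      by (simp add: b_def)
    also have "(\<Sum>j\<in>X - {i}. b i j) = (\<Sum>j\<in>X - {i}. a i j)"
      by (rule sum.cong) (auto simp: b_def)
    finally show ?thesis by simp
  qed
  then have "(\<Sum>i\<in>X. \<Sum>j\<in>X - {i}. a i j) = (\<Sum>i\<in>X. \<Sum>j\<in>X. b i j)"
    by (rule sum.cong[OF refl])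
  moreover have "(\<Sum>i\<in>X. \<Sum>j\<in>X. b i j) = - (\<Sum>i\<in>X. \<Sum>j\<in>X. b i j)"
  proof -
    have "(\<Sum>i\<in>X. \<Sum>j\<in>X. b i j) = (\<Sum>i\<in>X. \<Sum>j\<in>X. b j i)"
      by (rule sum.swap)
    also have "\<dots> = (\<Sum>i\<in>X. \<Sum>j\<in>X. - b i j)"
    proof (intro sum.cong refl)
      fix i j assume "i \<in> X" "j \<in> X"
      then show "b j i = - b i j"
        using assms(2)[of j i] by (cases "i = j") (simp_all add: b_def)
    qed
    finally show ?thesis unfolding sum_negf .
  qed
  ultimately show ?thesis by linarith
qed

text \<open>The simplicial coboundary on total functions, for all degrees and all complexes at once.\<close>
definition delta :: "(nat set \<Rightarrow> int) \<Rightarrow> nat set \<Rightarrow> int"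
  where "delta f J = (\<Sum>j\<in>J. eps j J * f (J - {j}))"

lemma delta_add: "delta (f + g) = delta f + delta g"
  by (simp add: fun_eq_iff delta_def distrib_left sum.distrib)

lemma delta_delta:
  assumes "finite J"
  shows "delta (delta f) J = 0"
proof -
  have "delta (delta f) J = (\<Sum>i\<in>J. \<Sum>j\<in>J - {i}. eps i J * eps j (J - {i}) * f (J - {i, j}))"
    unfolding delta_def sum_distrib_left
    by (simp only: mult.assoc Diff_insert2[of J _ "{_}"])
  also have "\<dots> = 0"
  proof (rule antisymmetric_sum_zero[OF assms])
    fix i j assume "i \<in> J" "j \<in> J" "i \<noteq> j"
    then show "eps i J * eps j (J - {i}) * f (J - {i, j}) = - (eps j J * eps i (J - {j}) * f (J - {j, i}))"
      unfolding eps_exchange[OF assms \<open>i \<in> J\<close> \<open>j \<in> J\<close> \<open>i \<noteq> j\<close>] insert_commute[of j i "{}"]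
      by (simp only: mult_minus_left)
  qed
  finally show ?thesis .
qed

section \<open>Reduced cohomology through cochains\<close>
definition face_closed :: "nat set set \<Rightarrow> bool"
  where "face_closed K \<longleftrightarrow> (\<forall>J\<in>K. finite J \<and> (\<forall>I\<subseteq>J. I \<in> K))"

lemma facet_simplex:
  assumes "face_closed K" "J \<in> simplices K p" "j \<in> J"
  shows "J - {j} \<in> simplices K (p - 1)"
proof -
  have "card J = Suc (card (J - {j}))" "J - {j} \<in> K"
    using assms card.remove[of J j] unfolding simplices_def face_closed_def by blast+
  then show ?thesis
    using assms by (simp add: simplices_def)
qed

lemma finite_simplex: "face_closed K \<Longrightarrow> J \<in> simplices K p \<Longrightarrow> finite J"
  by (simp add: simplices_def face_closed_def)

lemma coboundary_restrict:
  assumes "face_closed K"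
  shows "coboundary K p (restrict f (simplices K p)) = restrict (delta f) (simplices K (p + 1))"
proof -
  have "J - {j} \<in> simplices K p" if "J \<in> simplices K (p + 1)" "j \<in> J" for J j
    using facet_simplex[OF assms that] by simp
  then show ?thesis
    unfolding coboundary_def delta_def by (intro restrict_ext sum.cong) simp_all
qed

lemma presented_group_cochain_group:
  "presented_group UNIV {f. \<forall>J\<in>simplices K p. f J = 0} (\<lambda>f. restrict f (simplices K p))
    (cochain_group K p)"
proof (rule presented_group.intro)
  have "group (cochain_group K p)"
    unfolding cochain_group_def by simp
  then show "comm_group (cochain_group K p)"
    by (rule group.group_comm_groupI) (auto simp: cochain_group_def fun_eq_iff)
  show "range (\<lambda>f. restrict f (simplices K p)) = carrier (cochain_group K p)"
  proof (rule equalityI; rule subsetI)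
    fix x assume "x \<in> carrier (cochain_group K p)"
    then have "x = restrict x (simplices K p)"
      by (simp add: cochain_group_def PiE_iff extensional_restrict)
    then show "x \<in> range (\<lambda>f. restrict f (simplices K p))"
      by (rule range_eqI[where f = "\<lambda>f. restrict f (simplices K p)"])
  qed (auto simp: cochain_group_def)
qed (auto simp: cochain_group_def fun_eq_iff restrict_def)

definition cohomology_class :: "nat set set \<Rightarrow> int \<Rightarrow> (nat set \<Rightarrow> int) \<Rightarrow> (nat set \<Rightarrow> int) set"
  where "cohomology_class K p f =
    coboundary K (p - 1) ` carrier (cochain_group K (p - 1))
      #>\<^bsub>cochain_group K p\<^esub> restrict f (simplices K p)"

definition cocycles :: "nat set set \<Rightarrow> int \<Rightarrow> (nat set \<Rightarrow> int) set"
  where "cocycles K p = {f. \<forall>J\<in>simplices K (p + 1). delta f J = 0}"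

definition coboundaries :: "nat set set \<Rightarrow> int \<Rightarrow> (nat set \<Rightarrow> int) set"
  where "coboundaries K p = {f. \<exists>c. \<forall>J\<in>simplices K p. f J = delta c J}"

lemma presented_group_reduced_cohomology:
  assumes "face_closed K"
  shows "presented_group (cocycles K p) (coboundaries K p) (cohomology_class K p)
    (reduced_cohomology K p)"
proof -
  have "presented_group {y \<in> UNIV. delta y \<in> {f. \<forall>J\<in>simplices K (p + 1). f J = 0}}
     {y \<in> UNIV. \<exists>x\<in>UNIV. y - delta x \<in> {f. \<forall>J\<in>simplices K p. f J = 0}}
     (\<lambda>y. coboundary K (p - 1) ` carrier (cochain_group K (p - 1))
        #>\<^bsub>cochain_group K p\<^esub> restrict y (simplices K p))
     (cohomology_at (cochain_group K (p - 1)) (coboundary K (p - 1)) (cochain_group K p)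
       (coboundary K p) (cochain_group K (p + 1)))"
  proof (rule presented_group_cohomology_at[OF presented_group_cochain_group
        presented_group_cochain_group presented_group_cochain_group])
    show "delta (delta x) \<in> {f. \<forall>J\<in>simplices K (p + 1). f J = 0}" for x
      using finite_simplex[OF assms] delta_delta by blast
  qed (use coboundary_restrict[OF assms, of "p - 1"] coboundary_restrict[OF assms, of p] in
      \<open>simp_all add: delta_add\<close>)
  then show ?thesis
    by (simp add: reduced_cohomology_def cocycles_def coboundaries_def cohomology_class_def[abs_def])
qed

text \<open>In terms of cochains the induced map is restriction: adding coboundaries of the larger and of
  the smaller complex amounts to adding coboundaries of the smaller one, as the former restrict to
  the latter.\<close>
lemma cohomology_restriction_class:
  assumes K: "face_closed K" and L: "face_closed L" and "L \<subseteq> K"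
  shows "cohomology_restriction L p (cohomology_class K p f) = cohomology_class L p f"
proof -
  let ?res = "\<lambda>f. restrict f (simplices L p)"
  have sub: "simplices L p \<subseteq> simplices K p"
    using assms(3) by (auto simp: simplices_def)
  have B: "coboundary M (p - 1) ` carrier (cochain_group M (p - 1))
      = range (\<lambda>c. restrict (delta c) (simplices M p))" if "face_closed M" for M
    unfolding presented_group.onto[OF presented_group_cochain_group, symmetric] image_image
    using coboundary_restrict[OF that, of "p - 1"] by simp
  have as_range: "cohomology_class M p f = range (\<lambda>c. restrict (delta c + f) (simplices M p))"
    if "face_closed M" for M
    unfolding cohomology_class_def B[OF that] r_coset_def
    by (auto simp: cochain_group_def fun_eq_iff image_iff)
  have "?res ` cohomology_class K p f = range (\<lambda>c. ?res (delta c + f))"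
    unfolding as_range[OF K] image_image using sub by (intro image_cong) (auto simp: fun_eq_iff)
  then have "cohomology_restriction L p (cohomology_class K p f)
      = (\<Union>a. \<Union>b. {?res (delta a) \<otimes>\<^bsub>cochain_group L p\<^esub> ?res (delta b + f)})"
    unfolding cohomology_restriction_def B[OF L] set_mult_def by simp
  also have "\<dots> = (\<Union>a. \<Union>b. {?res (delta (a + b) + f)})"
    by (simp add: cochain_group_def delta_add add.assoc cong: restrict_cong)
  also have "\<dots> = cohomology_class L p f"
  proof -
    have "\<exists>a b. ?res (delta c + f) = ?res (delta (a + b) + f)" for c
      by (rule exI[of _ 0]) auto
    then show ?thesis
      unfolding as_range[OF L] by auto
  qed
  finally show ?thesis .
qed

section \<open>Double cohomology through families of cochains\<close>

text \<open>The differential \<open>d'\<close> on families of cochains, without the global sign \<open>(-1)\<^sup>p\<^sup>+\<^sup>1\<close>. That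
  sign is constant along a row, so it changes neither kernels nor images, and without it
  \<open>cube_diff\<close> commutes with the simplicial coboundary.\<close>
definition cube_diff :: "nat \<Rightarrow> (nat set \<Rightarrow> nat set \<Rightarrow> int) \<Rightarrow> nat set \<Rightarrow> nat set \<Rightarrow> int"
  where "cube_diff m F I J = (\<Sum>i\<in>{1..m} - I. eps i (insert i I) * F (insert i I) J)"

lemma cube_diff_add: "cube_diff m (F + G) = cube_diff m F + cube_diff m G"
  by (simp add: fun_eq_iff cube_diff_def algebra_simps sum.distrib)

lemma cube_diff_cube_diff:
  assumes "finite I"
  shows "cube_diff m (cube_diff m F) I J = 0"
proof -
  let ?M = "\<lambda>i j. insert i (insert j I)"
  have "cube_diff m (cube_diff m F) I J =
      (\<Sum>i\<in>{1..m} - I. \<Sum>j\<in>({1..m} - I) - {i}. eps i (insert i I) * eps j (?M i j) * F (?M i j) J)"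
    unfolding cube_diff_def
  proof (intro sum.cong refl)
    fix i assume "i \<in> {1..m} - I"
    moreover have "{1..m} - insert i I = ({1..m} - I) - {i}" by auto
    ultimately show "eps i (insert i I) * (\<Sum>j\<in>{1..m} - insert i I. eps j (insert j (insert i I)) * F (insert j (insert i I)) J)
       = (\<Sum>j\<in>({1..m} - I) - {i}. eps i (insert i I) * eps j (?M i j) * F (?M i j) J)"
      by (simp only: sum_distrib_left mult.assoc insert_commute[of j i I for j])
  qed
  also have "\<dots> = 0"
  proof (rule antisymmetric_sum_zero)
    fix i j assume ij: "i \<in> {1..m} - I" "j \<in> {1..m} - I" "i \<noteq> j"
    then have "?M i j - {j} = insert i I" "?M i j - {i} = insert j I" by auto
    moreover have "eps j (?M i j) * eps i (?M i j - {j}) = - (eps i (?M i j) * eps j (?M i j - {i}))"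
      by (rule eps_exchange) (use ij assms in auto)
    ultimately have "eps i (insert i I) * eps j (?M i j) = - (eps j (insert j I) * eps i (?M i j))"
      by (simp only: mult.commute)
    then show "eps i (insert i I) * eps j (?M i j) * F (?M i j) J
        = - (eps j (insert j I) * eps i (?M j i) * F (?M j i) J)"
      unfolding insert_commute[of j i I] by (simp only: mult_minus_left)
  qed simp
  finally show ?thesis .
qed

lemma delta_cube_diff: "delta (cube_diff m F I) J = cube_diff m (\<lambda>I. delta (F I)) I J"
  unfolding delta_def cube_diff_def sum_distrib_left
  by (subst sum.swap) (simp add: mult.left_commute)

definition cocycle_families :: "nat \<Rightarrow> nat set set \<Rightarrow> int \<Rightarrow> int \<Rightarrow> (nat set \<Rightarrow> nat set \<Rightarrow> int) set"
  where "cocycle_families m K p l =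
    {F. \<forall>I\<in>index_sets m l. F I \<in> cocycles (full_subcomplex K I) p}"

definition coboundary_families :: "nat \<Rightarrow> nat set set \<Rightarrow> int \<Rightarrow> int \<Rightarrow> (nat set \<Rightarrow> nat set \<Rightarrow> int) set"
  where "coboundary_families m K p l =
    {F. \<forall>I\<in>index_sets m l. F I \<in> coboundaries (full_subcomplex K I) p}"

definition family_class ::
  "nat \<Rightarrow> nat set set \<Rightarrow> int \<Rightarrow> int \<Rightarrow> (nat set \<Rightarrow> nat set \<Rightarrow> int) \<Rightarrow> nat set \<Rightarrow> (nat set \<Rightarrow> int) set"
  where "family_class m K p l F =
    (\<lambda>I\<in>index_sets m l. cohomology_class (full_subcomplex K I) p (F I))"

lemma finite_index_sets: "finite (index_sets m l)"
  by (rule finite_subset[of _ "Pow {1..m}"]) (auto simp: index_sets_def)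

lemma face_closed_full_subcomplex: "face_closed K \<Longrightarrow> face_closed (full_subcomplex K I)"
  by (auto simp: face_closed_def full_subcomplex_def)

lemma presented_group_ma_cohomology:
  assumes "face_closed K" "p = l - k - 1"
  shows "presented_group (cocycle_families m K p l) (coboundary_families m K p l)
    (family_class m K p l) (ma_cohomology m K k l)"
  using presented_group_sum_group[OF finite_index_sets presented_group_reduced_cohomology,
      OF face_closed_full_subcomplex[OF assms(1)], of m l "\<lambda>I. I" "\<lambda>_. p"]
  unfolding cocycle_families_def coboundary_families_def family_class_def ma_cohomology_def assms(2)
  by simp

lemma insert_index_set:
  assumes "J \<in> index_sets m (l - 1)" "i \<in> {1..m} - J"
  shows "insert i J \<in> index_sets m l"
proof -
  have "finite J" using assms(1) finite_subset by (auto simp: index_sets_def)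
  then show ?thesis using assms by (auto simp: index_sets_def)
qed

lemma (in presented_group) hom_sign:
  fixes s :: int
  assumes "x \<in> Z" "s = 1 \<or> s = - 1"
  shows "q x [^]\<^bsub>G\<^esub> s = q (if s = 1 then x else - x) \<and> (if s = 1 then x else - x) \<in> Z"
  using assms closed[of x] hom_neg[of x] neg[of x] G.int_pow_neg[of "q x" 1]
  by (auto simp: G.int_pow_1)

lemma full_subcomplex_mono: "I \<subseteq> I' \<Longrightarrow> full_subcomplex K I \<subseteq> full_subcomplex K I'"
  by (auto simp: full_subcomplex_def)

lemma cocycles_mono: "L \<subseteq> K \<Longrightarrow> cocycles K p \<subseteq> cocycles L p"
  by (auto simp: cocycles_def simplices_def)

text \<open>On classes of families, \<open>d'\<close> is \<open>cube_diff\<close> up to the sign of the row. The cochain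
  \<open>F (insert i J)\<close> lives on a larger complex than that of \<open>J\<close>, but it is read there as it stands.\<close>
lemma double_differential_class:
  assumes K: "face_closed K" and F: "F \<in> cocycle_families m K p l" and p: "p = l - k - 1"
  defines "G \<equiv> \<lambda>I J. (-1) ^ nat (p + 1) * cube_diff m F I J"
  shows "double_differential m K k l (family_class m K p l F) = family_class m K p (l - 1) G"
    and "G \<in> cocycle_families m K p (l - 1)"
proof -
  have *: "(\<Otimes>\<^bsub>reduced_cohomology (full_subcomplex K J) p\<^esub>i\<in>{1..m} - J.
         cohomology_restriction (full_subcomplex K J) p (family_class m K p l F (insert i J))
           [^]\<^bsub>reduced_cohomology (full_subcomplex K J) p\<^esub>
         ((-1) ^ nat (p + 1) * eps i (insert i J))) = cohomology_class (full_subcomplex K J) p (G J)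
       \<and> G J \<in> cocycles (full_subcomplex K J) p"
    if J: "J \<in> index_sets m (l - 1)" for J
  proof -
    let ?R = "reduced_cohomology (full_subcomplex K J) p"
    let ?q = "cohomology_class (full_subcomplex K J) p"
    interpret R: presented_group "cocycles (full_subcomplex K J) p"
      "coboundaries (full_subcomplex K J) p" ?q ?R
      using K by (intro presented_group_reduced_cohomology face_closed_full_subcomplex)
    define s where "s i = (-1) ^ nat (p + 1) * eps i (insert i J)" for i
    have s: "s i = 1 \<or> s i = -1" for i
      using eps_sign[of i "insert i J"] sign_cases[of "nat (p + 1)"]
      by (auto simp: s_def)
    define f where "f i = (if s i = 1 then F (insert i J) else - F (insert i J))" for i
    have f: "f i = (\<lambda>\<sigma>. s i * F (insert i J) \<sigma>)" for i
      using s[of i] by (auto simp: f_def fun_eq_iff)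
    have ins: "F (insert i J) \<in> cocycles (full_subcomplex K J) p"
      and cls: "cohomology_restriction (full_subcomplex K J) p (family_class m K p l F (insert i J))
        = ?q (F (insert i J))" if "i \<in> {1..m} - J" for i
    proof -
      have I: "insert i J \<in> index_sets m l"
        using insert_index_set[OF J that] .
      have sub: "full_subcomplex K J \<subseteq> full_subcomplex K (insert i J)"
        by (rule full_subcomplex_mono) auto
      show "F (insert i J) \<in> cocycles (full_subcomplex K J) p"
        using F I cocycles_mono[OF sub] by (auto simp: cocycle_families_def)
      show "cohomology_restriction (full_subcomplex K J) p (family_class m K p l F (insert i J))
        = ?q (F (insert i J))"
        using cohomology_restriction_class[OF _ _ sub] face_closed_full_subcomplex[OF K] I
        by (simp add: family_class_def)
    qed
    have "(\<Otimes>\<^bsub>?R\<^esub>i\<in>{1..m} - J. cohomology_restriction (full_subcomplex K J) p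
          (family_class m K p l F (insert i J)) [^]\<^bsub>?R\<^esub> s i) = (\<Otimes>\<^bsub>?R\<^esub>i\<in>{1..m} - J. ?q (f i))"
      using R.hom_sign[OF ins s] R.closed
      by (intro R.G.finprod_cong') (auto simp: cls f_def)
    also have "\<dots> = ?q (\<Sum>i\<in>{1..m} - J. f i)" "(\<Sum>i\<in>{1..m} - J. f i) \<in> cocycles (full_subcomplex K J) p"
      using R.hom_sum[of "{1..m} - J" f] R.hom_sign[OF ins s] by (auto simp: f_def)
    moreover have "(\<Sum>i\<in>{1..m} - J. f i) = G J"
      by (auto simp: fun_eq_iff sum_fun_apply f s_def G_def cube_diff_def sum_distrib_left mult.assoc)
    ultimately show ?thesis
      by (simp add: s_def)
  qed
  show "double_differential m K k l (family_class m K p l F) = family_class m K p (l - 1) G"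
    unfolding double_differential_def Let_def p[symmetric] family_class_def[of m K p "l - 1"]
    using * by (intro restrict_ext) blast
  show "G \<in> cocycle_families m K p (l - 1)"
    using * by (auto simp: cocycle_families_def)
qed

definition double_cocycles :: "nat \<Rightarrow> nat set set \<Rightarrow> int \<Rightarrow> int \<Rightarrow> (nat set \<Rightarrow> nat set \<Rightarrow> int) set"
  where "double_cocycles m K p l =
    {F \<in> cocycle_families m K p l. cube_diff m F \<in> coboundary_families m K p (l - 1)}"

definition double_coboundaries :: "nat \<Rightarrow> nat set set \<Rightarrow> int \<Rightarrow> int \<Rightarrow> (nat set \<Rightarrow> nat set \<Rightarrow> int) set"
  where "double_coboundaries m K p l =
    {F \<in> cocycle_families m K p l.
      \<exists>G\<in>cocycle_families m K p (l + 1). F - cube_diff m G \<in> coboundary_families m K p l}"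

text \<open>The passage from the double cohomology to integer-valued functions: cocycles are families
  \<open>F\<close> of simplicial cocycles for which \<open>cube_diff m F\<close> consists of coboundaries, and they are
  identified when they differ by some \<open>cube_diff m G\<close>, with \<open>G\<close> a family of cocycles, and a family of
  coboundaries.\<close>
lemma presented_group_HH:
  assumes K: "face_closed K" and p: "p = l - k - 1"
  shows "\<exists>q. presented_group (double_cocycles m K p l) (double_coboundaries m K p l) q (HH m K k l)"
proof -
  define s :: int where "s = (-1) ^ nat (p + 1)"
  have s: "s = 1 \<or> s = - 1"
    unfolding s_def by (rule sign_cases)
  define D where "D = (\<lambda>F I J. s * cube_diff m F I J)"
  have D: "D F = (if s = 1 then cube_diff m F else - cube_diff m F)" for F
    using s by (auto simp: D_def fun_eq_iff)
  have cube_neg: "cube_diff m (- F) = - cube_diff m F" for F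
    by (simp add: cube_diff_def fun_eq_iff sum_negf)
  have add: "D (F + G) = D F + D G" for F G
    by (simp add: D cube_diff_add)
  note MA = presented_group_ma_cohomology[OF K, of p]
  have p': "p = (l + 1) - (k + 1) - 1" "p = (l - 1) - (k - 1) - 1"
    using p by simp_all
  interpret M1: presented_group "cocycle_families m K p (l + 1)" "coboundary_families m K p (l + 1)"
    "family_class m K p (l + 1)" "ma_cohomology m K (k + 1) (l + 1)"
    by (rule MA[OF p'(1)])
  interpret M3: presented_group "cocycle_families m K p (l - 1)" "coboundary_families m K p (l - 1)"
    "family_class m K p (l - 1)" "ma_cohomology m K (k - 1) (l - 1)"
    by (rule MA[OF p'(2)])
  have neg3: "- F \<in> coboundary_families m K p (l - 1)" if "F \<in> coboundary_families m K p (l - 1)" for F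
  proof -
    have "F \<in> cocycle_families m K p (l - 1)"
      using that M3.relators by blast
    then show ?thesis
      using that M3.eq_one_iff[of F] M3.eq_one_iff[of "- F"] M3.hom_neg M3.neg by simp
  qed
  have DD: "D (D F) \<in> coboundary_families m K p (l - 1)" for F
  proof -
    have "D (D F) I J = 0" if "finite I" for I J
      using cube_diff_cube_diff[OF that, of m F J] by (simp add: D cube_neg)
    moreover have "finite I" if "I \<in> index_sets m (l - 1)" for I
      using that finite_subset by (auto simp: index_sets_def)
    ultimately show ?thesis
      by (auto simp: coboundary_families_def coboundaries_def delta_def intro!: exI[of _ "\<lambda>_. 0"])
  qed
  have "presented_group
      {F \<in> cocycle_families m K p l. D F \<in> coboundary_families m K p (l - 1)}
      {F \<in> cocycle_families m K p l.
         \<exists>G\<in>cocycle_families m K p (l + 1). F - D G \<in> coboundary_families m K p l}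
      (\<lambda>F. double_differential m K (k + 1) (l + 1) ` carrier (ma_cohomology m K (k + 1) (l + 1))
         #>\<^bsub>ma_cohomology m K k l\<^esub> family_class m K p l F)
      (HH m K k l)"
    unfolding HH_def
  proof (rule presented_group_cohomology_at[OF MA[OF p'(1)] MA[OF p] MA[OF p'(2)]])
    fix F assume F: "F \<in> cocycle_families m K p (l + 1)"
    show "D F \<in> cocycle_families m K p l"
      "double_differential m K (k + 1) (l + 1) (family_class m K p (l + 1) F)
        = family_class m K p l (D F)"
      using double_differential_class[OF K F p'(1)] by (simp_all add: D_def s_def)
    show "D (D F) \<in> coboundary_families m K p (l - 1)"
      by (rule DD)
  next
    fix F assume F: "F \<in> cocycle_families m K p l"
    show "D F \<in> cocycle_families m K p (l - 1)"
      "double_differential m K k l (family_class m K p l F) = family_class m K p (l - 1) (D F)"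
      using double_differential_class[OF K F p] by (simp_all add: D_def s_def)
  qed (rule add)+
  moreover have "{F \<in> cocycle_families m K p l. D F \<in> coboundary_families m K p (l - 1)}
      = double_cocycles m K p l"
  proof -
    have "D F \<in> coboundary_families m K p (l - 1) \<longleftrightarrow> cube_diff m F \<in> coboundary_families m K p (l - 1)" for F
      unfolding D using neg3[of "cube_diff m F"] neg3[of "- cube_diff m F"] by auto
    then show ?thesis
      unfolding double_cocycles_def by simp
  qed
  moreover have "{F \<in> cocycle_families m K p l.
         \<exists>G\<in>cocycle_families m K p (l + 1). F - D G \<in> coboundary_families m K p l}
      = double_coboundaries m K p l"
  proof -
    have "(\<exists>G\<in>cocycle_families m K p (l + 1). F - D G \<in> coboundary_families m K p l) \<longleftrightarrow>
      (\<exists>G\<in>cocycle_families m K p (l + 1). F - cube_diff m G \<in> coboundary_families m K p l)" for F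
    proof (cases "s = 1")
      case False
      then have "D (- G) = cube_diff m G" for G
        by (simp add: D cube_neg)
      then have "D G = cube_diff m (- G)" for G
        using False by (simp add: D cube_neg)
      then show ?thesis
        using M1.neg \<open>\<And>G. D (- G) = cube_diff m G\<close> by metis
    qed (simp add: D)
    then show ?thesis
      unfolding double_coboundaries_def by simp
  qed
  ultimately show ?thesis
    by auto
qed

section \<open>The double complex and its contractible direction\<close>
definition Delta :: "(nat set \<Rightarrow> nat set \<Rightarrow> int) \<Rightarrow> nat set \<Rightarrow> nat set \<Rightarrow> int"
  where "Delta F I = delta (F I)"

text \<open>Equality in the double complex at \<open>(p, l)\<close>, that is, at the index sets \<open>I\<close> with \<open>l\<close> elements
  and the \<open>p\<close>-simplices inside \<open>I\<close>.\<close>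
definition agree :: "nat \<Rightarrow> nat set set \<Rightarrow> int \<Rightarrow> int \<Rightarrow>
    (nat set \<Rightarrow> nat set \<Rightarrow> int) \<Rightarrow> (nat set \<Rightarrow> nat set \<Rightarrow> int) \<Rightarrow> bool"
  where "agree m K p l F G \<longleftrightarrow>
    (\<forall>I\<in>index_sets m l. \<forall>J\<in>simplices (full_subcomplex K I) p. F I J = G I J)"

lemma agree_sym: "agree m K p l F G \<Longrightarrow> agree m K p l G F"
  by (simp add: agree_def)

lemma agree_trans [trans]:
  "agree m K p l F G \<Longrightarrow> agree m K p l G H \<Longrightarrow> agree m K p l F H"
  by (simp add: agree_def)

lemma agree_minus:
  "agree m K p l F F' \<Longrightarrow> agree m K p l G G' \<Longrightarrow> agree m K p l (F - G) (F' - G')"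
  by (simp add: agree_def)

lemma agree_minus_iff: "agree m K p l (F - G) 0 \<longleftrightarrow> agree m K p l F G"
  by (simp add: agree_def)

lemma delta_diff: "delta (f - g) = delta f - delta g"
  by (simp add: fun_eq_iff delta_def right_diff_distrib sum_subtractf)

lemma Delta_add: "Delta (F + G) = Delta F + Delta G"
  by (simp add: fun_eq_iff Delta_def delta_add)

lemma Delta_diff: "Delta (F - G) = Delta F - Delta G"
  by (simp add: fun_eq_iff Delta_def delta_diff)

lemma cube_diff_diff: "cube_diff m (F - G) = cube_diff m F - cube_diff m G"
  by (simp add: fun_eq_iff cube_diff_def right_diff_distrib sum_subtractf)

lemma Delta_zero: "Delta 0 = 0"
  by (simp add: fun_eq_iff Delta_def delta_def)

lemma cube_diff_zero: "cube_diff m 0 = 0"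
  by (simp add: fun_eq_iff cube_diff_def)

lemma Delta_cube_diff: "Delta (cube_diff m F) = cube_diff m (Delta F)"
  by (simp add: fun_eq_iff Delta_def[abs_def] delta_cube_diff)

lemma agree_cube_diff:
  assumes "agree m K p l F G"
  shows "agree m K p (l - 1) (cube_diff m F) (cube_diff m G)"
  unfolding agree_def cube_diff_def
proof (intro ballI sum.cong refl)
  fix I J i
  assume I: "I \<in> index_sets m (l - 1)" and J: "J \<in> simplices (full_subcomplex K I) p"
    and i: "i \<in> {1..m} - I"
  have "J \<in> simplices (full_subcomplex K (insert i I)) p"
    using J by (auto simp: simplices_def full_subcomplex_def)
  then have "F (insert i I) J = G (insert i I) J"
    using assms insert_index_set[OF I i] unfolding agree_def by blast
  then show "eps i (insert i I) * F (insert i I) J = eps i (insert i I) * G (insert i I) J"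
    by simp
qed

lemma agree_Delta:
  assumes "face_closed K" "agree m K p l F G"
  shows "agree m K (p + 1) l (Delta F) (Delta G)"
  unfolding agree_def Delta_def delta_def
proof (intro ballI sum.cong refl)
  fix I J j
  assume I: "I \<in> index_sets m l" and J: "J \<in> simplices (full_subcomplex K I) (p + 1)" "j \<in> J"
  have "J - {j} \<in> simplices (full_subcomplex K I) p"
    using facet_simplex[OF face_closed_full_subcomplex[OF assms(1)] J] by simp
  then show "eps j J * F I (J - {j}) = eps j J * G I (J - {j})"
    using assms(2) I unfolding agree_def by simp
qed

lemma finite_index_set: "I \<in> index_sets m l \<Longrightarrow> finite I"
  using finite_subset by (auto simp: index_sets_def)

lemma cube_diff_cube_diff_agree: "agree m K p l (cube_diff m (cube_diff m F)) 0"
  using cube_diff_cube_diff finite_index_set by (auto simp: agree_def)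

lemma Delta_Delta_agree:
  assumes "face_closed K"
  shows "agree m K p l (Delta (Delta F)) 0"
  using delta_delta finite_simplex[OF face_closed_full_subcomplex[OF assms]]
  by (auto simp: agree_def Delta_def)

lemma cocycle_families_agree:
  "F \<in> cocycle_families m K p l \<longleftrightarrow> agree m K (p + 1) l (Delta F) 0"
  by (auto simp: cocycle_families_def cocycles_def agree_def Delta_def)

lemma coboundary_families_agree:
  "F \<in> coboundary_families m K p l \<longleftrightarrow> (\<exists>C. agree m K p l F (Delta C))"
  by (auto simp: coboundary_families_def coboundaries_def agree_def Delta_def bchoice_iff)

definition fresh :: "nat \<Rightarrow> nat set \<Rightarrow> nat"
  where "fresh m J = (LEAST w. w \<in> {1..m} - J)"

text \<open>The contraction of the cube of all \<open>I\<close> along one coordinate. The coordinate depends on \<open>J\<close>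
  and lies outside \<open>J\<close>, so that deleting it from \<open>I\<close> keeps \<open>J\<close> inside \<open>I\<close>.\<close>
definition cube_homotopy :: "nat \<Rightarrow> (nat set \<Rightarrow> nat set \<Rightarrow> int) \<Rightarrow> nat set \<Rightarrow> nat set \<Rightarrow> int"
  where "cube_homotopy m F I J =
    (if fresh m J \<in> I then eps (fresh m J) I * F (I - {fresh m J}) J else 0)"

lemma cube_homotopy_add: "cube_homotopy m (F + G) = cube_homotopy m F + cube_homotopy m G"
  by (auto simp: fun_eq_iff cube_homotopy_def distrib_left)

lemma eps_square: "eps i I * eps i I = 1"
  using eps_sign[of i I] by auto

text \<open>If \<open>w = fresh m J\<close> is not in \<open>I\<close>, the homotopy vanishes at \<open>I\<close> and at all \<open>insert i I\<close> except for
  \<open>i = w\<close>. If \<open>w\<close> is in \<open>I\<close>, the term for \<open>i = w\<close> of the second summand is \<open>F I J\<close>, and the other terms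
  cancel those of the first summand because \<open>i\<close> and \<open>w\<close> are added in opposite orders.\<close>
lemma cube_diff_homotopy:
  assumes I: "I \<subseteq> {1..m}" and w: "fresh m J \<in> {1..m}"
  shows "cube_diff m (cube_homotopy m F) I J + cube_homotopy m (cube_diff m F) I J = F I J"
proof -
  let ?w = "fresh m J"
  have fin: "finite I" using I finite_subset by blast
  show ?thesis
  proof (cases "?w \<in> I")
    case True
    let ?I' = "I - {?w}"
    have "{1..m} - ?I' = insert ?w ({1..m} - I)"
      using True I by auto
    moreover have "insert ?w ?I' = I" using True by auto
    moreover have "?w \<notin> {1..m} - I" using True by simp
    ultimately have "cube_diff m F ?I' J = eps ?w I * F I J
        + (\<Sum>i\<in>{1..m} - I. eps i (insert i ?I') * F (insert i ?I') J)"
      unfolding cube_diff_def by (simp only: sum.insert finite_Diff finite_atLeastAtMost not_False_eq_True)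
    then have "cube_homotopy m (cube_diff m F) I J = eps ?w I * eps ?w I * F I J
        + (\<Sum>i\<in>{1..m} - I. eps ?w I * eps i (insert i ?I') * F (insert i ?I') J)"
      using True by (simp add: cube_homotopy_def distrib_left sum_distrib_left mult.assoc)
    moreover have "cube_diff m (cube_homotopy m F) I J
        = (\<Sum>i\<in>{1..m} - I. eps i (insert i I) * eps ?w (insert i I) * F (insert i ?I') J)"
      unfolding cube_diff_def
    proof (rule sum.cong[OF refl])
      fix i assume "i \<in> {1..m} - I"
      then have "insert i I - {?w} = insert i ?I'" using True by auto
      then show "eps i (insert i I) * cube_homotopy m F (insert i I) J
          = eps i (insert i I) * eps ?w (insert i I) * F (insert i ?I') J"
        using True by (simp add: cube_homotopy_def)
    qed
    moreover have "(\<Sum>i\<in>{1..m} - I. eps ?w I * eps i (insert i ?I') * F (insert i ?I') J)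
        = (\<Sum>i\<in>{1..m} - I. - (eps i (insert i I) * eps ?w (insert i I) * F (insert i ?I') J))"
    proof (rule sum.cong[OF refl])
      fix i assume i: "i \<in> {1..m} - I"
      have "insert i I - {?w} = insert i ?I'" "insert i I - {i} = I" using True i by auto
      then have "eps ?w (insert i I) * eps i (insert i ?I') = - (eps i (insert i I) * eps ?w I)"
        using eps_exchange[of "insert i I" ?w i] True i fin by auto
      then have "eps ?w I * eps i (insert i ?I') = - (eps i (insert i I) * eps ?w (insert i I))"
        using eps_sign[of ?w I] eps_sign[of ?w "insert i I"] by auto
      then show "eps ?w I * eps i (insert i ?I') * F (insert i ?I') J
          = - (eps i (insert i I) * eps ?w (insert i I) * F (insert i ?I') J)"
        by simp
    qed
    ultimately show ?thesis
      by (simp add: eps_square sum_negf)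
  next
    case False
    have "cube_diff m (cube_homotopy m F) I J
        = (\<Sum>i\<in>{1..m} - I. if i = ?w then F I J else 0)"
      unfolding cube_diff_def
    proof (rule sum.cong[OF refl])
      fix i assume "i \<in> {1..m} - I"
      then show "eps i (insert i I) * cube_homotopy m F (insert i I) J = (if i = ?w then F I J else 0)"
        using False by (auto simp: cube_homotopy_def eps_square simp flip: mult.assoc)
    qed
    also have "\<dots> = F I J"
      using False w by simp
    finally show ?thesis
      using False by (simp add: cube_homotopy_def)
  qed
qed

lemma cube_exact:
  assumes fresh: "\<And>J. J \<in> K \<Longrightarrow> fresh m J \<in> {1..m} - J"
    and closed: "agree m K p (l - 1) (cube_diff m F) 0"
  shows "agree m K p l F (cube_diff m (cube_homotopy m F))"
  unfolding agree_def
proof (intro ballI)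
  fix I J
  assume I: "I \<in> index_sets m l" and J: "J \<in> simplices (full_subcomplex K I) p"
  let ?w = "fresh m J"
  have w: "?w \<in> {1..m} - J"
    using fresh J by (simp add: simplices_def full_subcomplex_def)
  have "cube_diff m F (I - {?w}) J = 0" if "?w \<in> I"
  proof -
    have "card I = Suc (card (I - {?w}))"
      using that finite_index_set[OF I] by (rule card.remove[rotated])
    then have "I - {?w} \<in> index_sets m (l - 1)"
      using I by (auto simp: index_sets_def)
    moreover have "J \<in> simplices (full_subcomplex K (I - {?w})) p"
      using J w by (auto simp: simplices_def full_subcomplex_def)
    ultimately show ?thesis
      using closed by (simp add: agree_def)
  qed
  then have "cube_homotopy m (cube_diff m F) I J = 0"
    by (simp add: cube_homotopy_def)
  moreover have "I \<subseteq> {1..m}"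
    using I by (simp add: index_sets_def)
  ultimately show "F I J = cube_diff m (cube_homotopy m F) I J"
    using cube_diff_homotopy[of I m J F] w by simp
qed

section \<open>Cohomology of the full subcomplexes of a polygon\<close>
lemma delta_vertex: "delta f {a} = f {}"
proof -
  have "{r \<in> {a}. r < a} = {}" by auto
  then have "eps a {a} = 1" unfolding eps_def by (simp only: card.empty power_0)
  then show ?thesis by (simp add: delta_def)
qed

lemma delta_edge:
  assumes "a < b"
  shows "delta f {a, b} = f {b} - f {a}"
proof -
  have "{r \<in> {a, b}. r < a} = {}" "{r \<in> {a, b}. r < b} = {a}"
    using assms by auto
  then have "eps a {a, b} = 1" "eps b {a, b} = - 1"
    unfolding eps_def by (simp_all only: card.empty power_0, simp)
  moreover have "{a, b} - {a} = {b}" "{a, b} - {b} = {a}"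
    using assms by auto
  ultimately show ?thesis
    using assms by (simp add: delta_def)
qed

locale polygon =
  fixes m :: nat and K :: "nat set set" and v :: "nat \<Rightarrow> nat"
  assumes m: "m \<ge> 5" and v: "bij_betw v {..<m} {1..m}"
    and K: "K = {{}} \<union> {{v i} | i. i < m} \<union> {{v i, v (Suc i mod m)} | i. i < m}"
begin

definition edge :: "nat \<Rightarrow> nat set"
  where "edge i = {v i, v (Suc i mod m)}"

text \<open>The coboundary compares the ends of an edge in the order of the integers; this sign compares
  that with the direction of travel around the polygon.\<close>
definition orientation :: "nat \<Rightarrow> int"
  where "orientation i = (if v i < v (Suc i mod m) then 1 else - 1)"

text \<open>The isomorphism from the first cohomology of the polygon to the integers.\<close>
definition winding :: "(nat set \<Rightarrow> int) \<Rightarrow> int"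
  where "winding e = (\<Sum>i<m. orientation i * e (edge i))"

lemma v_inj: "i < m \<Longrightarrow> j < m \<Longrightarrow> v i = v j \<longleftrightarrow> i = j"
  using v by (auto simp: bij_betw_def inj_on_def)

lemma v_range: "v ` {..<m} = {1..m}"
  using v by (simp add: bij_betw_def)

lemma succ_neq: "i < m \<Longrightarrow> Suc i mod m \<noteq> i"
  using m by (cases "Suc i = m") auto

lemma succ_less: "i < m \<Longrightarrow> Suc i mod m < m"
  by simp

lemma edge_card: "i < m \<Longrightarrow> card (edge i) = 2"
  using succ_neq[of i] v_inj[of i "Suc i mod m"] by (simp add: edge_def)

text \<open>Two vertices that follow each other in both directions would close up a \<open>2\<close>-gon.\<close>
lemma edge_inj:
  assumes "i < m" "j < m" "edge i = edge j"
  shows "i = j"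
proof (rule ccontr)
  assume "i \<noteq> j"
  then have "i = Suc j mod m" "Suc i mod m = j"
    using assms v_inj[OF assms(1,2)] v_inj[OF assms(1) succ_less[OF assms(2)]]
      v_inj[OF succ_less[OF assms(1)] assms(2)]
    by (auto simp: edge_def doubleton_eq_iff)
  moreover have "Suc k mod m = 0 \<and> Suc k = m \<or> Suc k mod m = Suc k" if "k < m" for k
    using that by (cases "Suc k = m") simp_all
  ultimately have "i = 0 \<and> Suc j = m \<or> i = Suc j" "j = 0 \<and> Suc i = m \<or> j = Suc i"
    using assms(1,2) by metis+
  then show False
    using m by arith
qed

lemma face_closed: "face_closed K"
proof -
  have "simplicial_complex_on m K"
    by (rule simplicial_complex_on_cycle_complex, unfold cycle_complex_def)
      (intro exI[of _ v] conjI v K)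
  then have "K \<subseteq> Pow {1..m}" "\<forall>J\<in>K. \<forall>I\<subseteq>J. I \<in> K"
    unfolding simplicial_complex_on_def by simp_all
  moreover have "finite J" if "J \<subseteq> {1..m}" for J
    using that by (rule finite_subset) simp
  ultimately show ?thesis
    unfolding face_closed_def by blast
qed

lemma in_K: "J \<in> K \<longleftrightarrow> J = {} \<or> (\<exists>a\<in>{1..m}. J = {a}) \<or> (\<exists>i<m. J = edge i)"
  unfolding K edge_def v_range[symmetric] by (simp add: bex_simps) (metis lessThan_iff)

lemma simplices_empty: "simplices (full_subcomplex K I) (- 1) = {{}}"
  using finite_simplex[OF face_closed] by (auto simp: simplices_def full_subcomplex_def in_K edge_card)

lemma simplices_vertex: "J \<in> simplices (full_subcomplex K I) 0 \<longleftrightarrow> (\<exists>a\<in>I \<inter> {1..m}. J = {a})"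
  by (auto simp: simplices_def full_subcomplex_def in_K edge_card)

lemma simplices_edge: "J \<in> simplices (full_subcomplex K I) 1 \<longleftrightarrow> (\<exists>i<m. J = edge i \<and> edge i \<subseteq> I)"
  by (auto simp: simplices_def full_subcomplex_def in_K edge_card)

lemma simplices_other: "p \<noteq> - 1 \<Longrightarrow> p \<noteq> 0 \<Longrightarrow> p \<noteq> 1 \<Longrightarrow> simplices (full_subcomplex K I) p = {}"
  by (auto simp: simplices_def full_subcomplex_def in_K edge_card)

lemma fresh_vertex:
  assumes "J \<in> K"
  shows "fresh m J \<in> {1..m} - J"
proof -
  have "card J \<le> 2"
    using assms by (auto simp: in_K edge_card)
  then have "\<not> {1..m} \<subseteq> J"
    using m face_closed assms card_mono[of J "{1..m}"] by (auto simp: face_closed_def)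
  then obtain w where "w \<in> {1..m} - J"
    by blast
  then show ?thesis
    unfolding fresh_def by (rule LeastI)
qed

lemma orientation_square: "orientation i * orientation i = 1"
  by (simp add: orientation_def)

lemma orientation_delta:
  assumes "i < m"
  shows "orientation i * delta f (edge i) = f {v (Suc i mod m)} - f {v i}"
proof (cases "v i < v (Suc i mod m)")
  case True
  then show ?thesis by (simp add: orientation_def edge_def delta_edge)
next
  case False
  then have "v (Suc i mod m) < v i"
    using v_inj[OF assms succ_less[OF assms]] succ_neq[OF assms] by linarith
  then have "delta f (edge i) = f {v i} - f {v (Suc i mod m)}"
    unfolding edge_def insert_commute[of "v i"] by (rule delta_edge)
  then show ?thesis using False by (simp add: orientation_def)
qed

lemma winding_add: "winding (e + e') = winding e + winding e'"
  by (simp add: winding_def distrib_left sum.distrib)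

lemma winding_cong: "(\<And>i. i < m \<Longrightarrow> e (edge i) = e' (edge i)) \<Longrightarrow> winding e = winding e'"
  by (simp add: winding_def)

text \<open>The sum around the cycle telescopes.\<close>
lemma winding_delta: "winding (delta f) = 0"
proof -
  have "winding (delta f) = (\<Sum>i<m. f {v (Suc i mod m)} - f {v (i mod m)})"
    unfolding winding_def by (intro sum.cong refl) (simp add: orientation_delta)
  also have "\<dots> = f {v (m mod m)} - f {v (0 mod m)}"
    by (rule sum_lessThan_telescope)
  finally show ?thesis by simp
qed

text \<open>A potential is found by summing along the polygon from \<open>v 0\<close>; it closes up at the last edge
  because the total sum is zero.\<close>
lemma winding_zero_exact:
  assumes "winding e = 0"
  shows "\<exists>f. \<forall>i<m. e (edge i) = delta f (edge i)"
proof -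
  define S where "S k = (\<Sum>j<k. orientation j * e (edge j))" for k
  define f where "f J = S (the_inv_into {..<m} v (the_elem J))" for J
  have f: "f {v i} = S i" if "i < m" for i
    using that v by (simp add: f_def the_inv_into_f_f bij_betw_def)
  have "e (edge i) = delta f (edge i)" if i: "i < m" for i
  proof -
    have "S (Suc i mod m) = S (Suc i)"
    proof (cases "Suc i = m")
      case True
      then show ?thesis using assms by (simp add: S_def winding_def)
    qed (use i in simp)
    then have "orientation i * delta f (edge i) = orientation i * e (edge i)"
      using i by (simp add: orientation_delta f S_def)
    then show ?thesis
      by (simp add: orientation_def split: if_splits)
  qed
  then show ?thesis by blast
qed

lemma winding_edge_unit:
  assumes "k < m"
  shows "winding (\<lambda>J. if J = edge k then c else 0) = orientation k * c"
proof -
  have "winding (\<lambda>J. if J = edge k then c else 0) = (\<Sum>i<m. if i = k then orientation k * c else 0)"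
    unfolding winding_def using edge_inj assms by (intro sum.cong refl) auto
  then show ?thesis using assms by simp
qed

text \<open>A full subcomplex on \<open>I \<noteq> [m]\<close> has no first cohomology: it misses an edge of the polygon, and a
  cochain on the other edges may be given whatever value on that edge makes its winding zero.\<close>
lemma proper_edge_exact:
  assumes "l \<noteq> int m"
  shows "\<exists>G. agree m K 1 l F (Delta G)"
proof -
  have "\<exists>f. \<forall>J\<in>simplices (full_subcomplex K I) 1. F I J = delta f J" if I: "I \<in> index_sets m l" for I
  proof -
    have "I \<noteq> {1..m}" "I \<subseteq> {1..m}"
      using I assms by (auto simp: index_sets_def)
    then obtain a where "a \<in> {1..m}" "a \<notin> I"
      by blast
    moreover from this have "a \<in> v ` {..<m}"
      using v_range by simp
    ultimately obtain k where k: "k < m" "v k \<notin> I"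
      by blast
    define c where "c = - orientation k * winding (F I)"
    define e where "e = F I + (\<lambda>J. if J = edge k then c else 0)"
    have "winding e = winding (F I) + orientation k * c"
      unfolding e_def winding_add winding_edge_unit[OF k(1)] ..
    also have "orientation k * c = - (orientation k * orientation k * winding (F I))"
      by (simp add: c_def)
    finally have "winding e = 0"
      unfolding orientation_square by simp
    from winding_zero_exact[OF this] obtain f where f: "\<forall>i<m. e (edge i) = delta f (edge i)"
      by (elim exE)
    have "F I J = delta f J" if J: "J \<in> simplices (full_subcomplex K I) 1" for J
    proof -
      obtain i where i: "i < m" "J = edge i" "edge i \<subseteq> I"
        using J unfolding simplices_edge by blast
      moreover have "v k \<in> edge k"
        by (simp add: edge_def)
      ultimately have "J \<noteq> edge k"
        using k by blast
      moreover have "e J = delta f J"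
        using f i(1,2) by blast
      ultimately show ?thesis by (simp add: e_def)
    qed
    then show ?thesis by blast
  qed
  then have "\<exists>G. \<forall>I\<in>index_sets m l. \<forall>J\<in>simplices (full_subcomplex K I) 1. F I J = delta (G I) J"
    by (intro bchoice ballI)
  then show ?thesis
    unfolding agree_def Delta_def .
qed

lemma top_index_sets: "index_sets m (int m) = {{1..m}}"
proof -
  have "I = {1..m}" if "I \<subseteq> {1..m}" "card I = m" for I
    using that by (intro card_subset_eq) simp_all
  moreover have "{1..m} \<in> index_sets m (int m)"
    by (simp add: index_sets_def)
  ultimately show ?thesis
    unfolding index_sets_def of_nat_eq_iff by blast
qed

text \<open>A full subcomplex on a nonempty \<open>I\<close> has a vertex, so \<open>H~\<^sup>-\<^sup>1\<close> vanishes.\<close>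
lemma Delta_injective_on_empty:
  assumes "l \<noteq> 0" "agree m K 0 l (Delta F) (Delta G)"
  shows "agree m K (- 1) l F G"
  unfolding agree_def simplices_empty
proof (intro ballI)
  fix I J :: "nat set" assume I: "I \<in> index_sets m l" and "J \<in> {{}}"
  then have "I \<noteq> {}"
    using assms(1) by (auto simp: index_sets_def)
  then obtain a where "a \<in> I" by blast
  then have "{a} \<in> simplices (full_subcomplex K I) 0"
    using I by (auto simp: simplices_vertex index_sets_def)
  then have "delta (F I) {a} = delta (G I) {a}"
    using assms(2) I unfolding agree_def Delta_def by blast
  then show "F I J = G I J"
    using \<open>J \<in> {{}}\<close> by (simp add: delta_vertex)
qed

lemma agree_top_winding:
  "agree m K 1 (int m) E E' \<Longrightarrow> winding (E {1..m}) = winding (E' {1..m})"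
proof (rule winding_cong)
  fix i assume "agree m K 1 (int m) E E'" "i < m"
  moreover have "edge i \<subseteq> {1..m}"
    using \<open>i < m\<close> v_range by (auto simp: edge_def simp del: atLeastAtMost_iff)
  ultimately show "E {1..m} (edge i) = E' {1..m} (edge i)"
    unfolding agree_def top_index_sets simplices_edge[abs_def] by (auto simp: simplices_edge)
qed

lemma agree_topI:
  assumes "\<And>i. i < m \<Longrightarrow> E {1..m} (edge i) = E' {1..m} (edge i)"
  shows "agree m K 1 (int m) E E'"
  unfolding agree_def top_index_sets using assms by (auto simp: simplices_edge)

section \<open>Diagram chases in the row of the vertices\<close>
abbreviation cube where "cube \<equiv> cube_diff m"
abbreviation homotopy where "homotopy \<equiv> cube_homotopy m"
abbreviation agr where "agr \<equiv> agree m K"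

lemma double_cocycles_iff:
  "F \<in> double_cocycles m K p l \<longleftrightarrow>
    agr (p + 1) l (Delta F) 0 \<and> (\<exists>C. agr p (l - 1) (cube F) (Delta C))"
  by (simp add: double_cocycles_def cocycle_families_agree coboundary_families_agree)

lemma double_coboundaries_iff:
  "F \<in> double_coboundaries m K p l \<longleftrightarrow>
    agr (p + 1) l (Delta F) 0 \<and>
    (\<exists>G. agr (p + 1) (l + 1) (Delta G) 0 \<and> (\<exists>C. agr p l (F - cube G) (Delta C)))"
  by (simp add: double_coboundaries_def cocycle_families_agree coboundary_families_agree Bex_def)

text \<open>Exactness in the direction of the index sets, with the primitive given explicitly so that it
  depends additively on the cocycle.\<close>
lemma row_exact: "agr p (l - 1) (cube F) 0 \<Longrightarrow> agr p l F (cube (homotopy F))"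
  by (rule cube_exact[OF fresh_vertex])

lemma cube_agree: "agr p l F G \<Longrightarrow> l' = l - 1 \<Longrightarrow> agr p l' (cube F) (cube G)"
  by (simp add: agree_cube_diff)

lemma Delta_agree: "agr p l F G \<Longrightarrow> p' = p + 1 \<Longrightarrow> agr p' l (Delta F) (Delta G)"
  by (simp add: agree_Delta[OF face_closed])

lemma Delta_Delta: "agr p l (Delta (Delta F)) 0"
  by (rule Delta_Delta_agree[OF face_closed])

lemma cube_cube: "agr p l (cube (cube F)) 0"
  by (rule cube_diff_cube_diff_agree)

text \<open>Once \<open>C\<close> is closed, \<open>C = cube C'\<close>, and subtracting the coboundary \<open>Delta C'\<close> from \<open>F\<close> makes it
  closed on the nose. Then it is \<open>cube G\<close>, and \<open>Delta G\<close> is closed because \<open>F\<close> consists of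
  cocycles.\<close>
lemma descend:
  assumes F: "agr 1 l (Delta F) 0" and C: "agr 0 (l - 1) (cube F) (Delta C)"
    and cC: "agr (- 1) (l - 2) (cube C) 0"
  shows "\<exists>C' G. agr 0 l (F - Delta C') (cube G) \<and> agr 1 l (cube (Delta G)) 0"
proof -
  let ?C' = "homotopy C"
  let ?F' = "F - Delta ?C'"
  let ?G = "homotopy ?F'"
  have "agr (- 1) (l - 1) C (cube ?C')"
    using cC by (intro row_exact) simp
  then have "agr 0 (l - 1) (Delta C) (cube (Delta ?C'))"
    using Delta_agree[of "- 1" "l - 1" C "cube ?C'" 0] by (simp add: Delta_cube_diff)
  with C have "agr 0 (l - 1) (cube F) (cube (Delta ?C'))"
    by (rule agree_trans)
  then have "agr 0 (l - 1) (cube ?F') 0"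
    by (simp add: cube_diff_diff agree_minus_iff)
  then have G: "agr 0 l ?F' (cube ?G)"
    by (rule row_exact)
  have "agr 1 l (Delta ?F') (cube (Delta ?G))"
    using Delta_agree[OF G] by (simp add: Delta_cube_diff)
  moreover have "agr 1 l (Delta ?F') (0 - 0)"
    unfolding Delta_diff using F Delta_Delta by (rule agree_minus)
  ultimately have "agr 1 l (cube (Delta ?G)) 0"
    by (simp add: agree_def)
  with G show ?thesis by blast
qed

text \<open>If \<open>Delta G = cube (Delta G')\<close>, then \<open>G - cube G'\<close> consists of cocycles and has the same image
  under \<open>cube\<close> as \<open>G\<close>. By exactness \<open>Delta G\<close> is some \<open>cube E\<close>, and what remains is to write \<open>E\<close> as a
  coboundary; by \<open>proper_edge_exact\<close> this is possible except on the whole polygon.\<close>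
lemma correct_by_lift:
  assumes "agr 1 l (Delta G) (cube E)" "agr 1 (l + 1) E (Delta G')"
  shows "agr 1 l (Delta (G - cube G')) 0"
proof -
  have "agr 1 l (cube E) (cube (Delta G'))"
    using cube_agree[OF assms(2)] by simp
  with assms(1) have "agr 1 l (Delta G) (cube (Delta G'))"
    by (rule agree_trans)
  then show ?thesis
    by (simp add: Delta_diff Delta_cube_diff agree_minus_iff)
qed

lemma correct_below_top:
  assumes "agr 1 (l - 1) (cube (Delta G)) 0" "l + 1 \<noteq> int m"
  shows "\<exists>G'. agr 1 l (Delta (G - cube G')) 0"
proof -
  obtain G' where "agr 1 (l + 1) (homotopy (Delta G)) (Delta G')"
    using proper_edge_exact[OF assms(2)] by blast
  with row_exact[OF assms(1)] show ?thesis
    by (blast intro: correct_by_lift)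
qed

lemma coboundary_if_descends:
  assumes F: "agr 1 l (Delta F) 0" and C: "agr 0 (l - 1) (cube F) (Delta C)"
    and cC: "agr (- 1) (l - 2) (cube C) 0" and l: "l \<noteq> int m - 2"
  shows "F \<in> double_coboundaries m K 0 l"
proof -
  obtain C' G where G: "agr 0 l (F - Delta C') (cube G)" "agr 1 l (cube (Delta G)) 0"
    using descend[OF F C cC] by blast
  obtain G' where G': "agr 1 (l + 1) (Delta (G - cube G')) 0"
    using correct_below_top[of "l + 1" G] G(2) l by auto
  have "agr 0 l (F - Delta C') (cube G - cube (cube G'))"
    using G(1) cube_cube[of 0 l G'] by (simp add: agree_def)
  then have "agr 0 l (F - cube (G - cube G')) (Delta C')"
    by (simp add: agree_def cube_diff_diff algebra_simps)
  with F G' show ?thesis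
    by (auto simp: double_coboundaries_iff)
qed

text \<open>\<open>Delta (cube C) = cube (cube F) = 0\<close>, and \<open>Delta\<close> is injective on functions of the empty simplex
  unless the index set is empty, that is, unless \<open>l = 2\<close>.\<close>
lemma closed_on_empty:
  assumes C: "agr 0 (l - 1) (cube F) (Delta C)" and l: "l \<noteq> 2"
  shows "agr (- 1) (l - 2) (cube C) 0"
proof -
  have "agr 0 (l - 2) (cube (cube F)) (cube (Delta C))"
    using cube_agree[OF C] by simp
  then have "agr 0 (l - 2) (Delta (cube C)) (Delta 0)"
    using cube_cube[of 0 "l - 2" F] by (simp add: Delta_cube_diff Delta_zero agree_def)
  then show ?thesis
    using l by (intro Delta_injective_on_empty) simp_all
qed

lemma HH_trivialI:
  assumes "double_cocycles m K (l - k - 1) l \<subseteq> double_coboundaries m K (l - k - 1) l"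
  shows "trivial_group (HH m K k l)"
proof -
  obtain q where "presented_group (double_cocycles m K (l - k - 1) l)
      (double_coboundaries m K (l - k - 1) l) q (HH m K k l)"
    using presented_group_HH[OF face_closed refl] by blast
  then show ?thesis
    using assms by (rule presented_group.trivial_groupI)
qed

lemma HH_isoI:
  fixes T :: "(nat set \<Rightarrow> nat set \<Rightarrow> int) set" and \<Phi> :: "_ \<Rightarrow> int"
  assumes p: "p = l - k - 1"
    and T: "0 \<in> T" "\<And>x y. x \<in> T \<Longrightarrow> y \<in> T \<Longrightarrow> x - y \<in> T"
    and \<theta>: "\<And>x. x \<in> T \<Longrightarrow> \<theta> x \<in> double_cocycles m K p l" "\<And>x y. \<theta> (x + y) = \<theta> x + \<theta> y"
    and \<Phi>: "\<And>x y. \<Phi> (x + y) = \<Phi> x + \<Phi> y"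
    and \<theta>_onto: "\<And>z. z \<in> double_cocycles m K p l \<Longrightarrow> \<exists>x\<in>T. z - \<theta> x \<in> double_coboundaries m K p l"
    and \<Phi>_onto: "\<exists>x\<in>T. \<Phi> x = 1"
    and kernels: "\<And>x. x \<in> T \<Longrightarrow> \<theta> x \<in> double_coboundaries m K p l \<longleftrightarrow> \<Phi> x = 0"
  shows "HH m K k l \<cong> integer_group"
proof -
  obtain q where "presented_group (double_cocycles m K p l) (double_coboundaries m K p l) q (HH m K k l)"
    using presented_group_HH[OF face_closed p] by blast
  from presented_group.iso_integer_groupI[OF this T \<theta> \<Phi> \<theta>_onto \<Phi>_onto kernels]
  show ?thesis .
qed

lemma zero_coboundary: "0 \<in> double_coboundaries m K p l"
  by (auto simp: double_coboundaries_iff Delta_zero cube_diff_zero agree_def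
      intro!: exI[of _ "0 :: nat set \<Rightarrow> nat set \<Rightarrow> int"])

section \<open>The rows of the empty simplex and of the edges\<close>
lemma HH_other_degree:
  assumes "l - k - 1 \<noteq> - 1" "l - k - 1 \<noteq> 0" "l - k - 1 \<noteq> 1"
  shows "trivial_group (HH m K k l)"
proof (rule HH_trivialI, rule subsetI)
  fix F assume "F \<in> double_cocycles m K (l - k - 1) l"
  then have "agr (l - k - 1 + 1) l (Delta F) 0"
    by (simp only: double_cocycles_iff)
  moreover have "agr (l - k - 1) l X Y" for X Y
    unfolding agree_def simplices_other[OF assms] by simp
  moreover have "agr (l - k - 1 + 1) (l + 1) (Delta 0) 0"
    by (simp add: Delta_zero agree_def)
  ultimately show "F \<in> double_coboundaries m K (l - k - 1) l"
    unfolding double_coboundaries_iff by blast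
qed

lemma bottom_coboundary:
  "F \<in> double_coboundaries m K (- 1) 0 \<longleftrightarrow> F {} {} = 0"
proof
  assume "F \<in> double_coboundaries m K (- 1) 0"
  then obtain G C where G: "agr 0 1 (Delta G) 0" and F: "agr (- 1) 0 (F - cube G) (Delta C)"
    by (auto simp: double_coboundaries_iff)
  have "agr 0 1 (Delta G) (Delta 0)"
    using G by (simp add: Delta_zero)
  then have "agr (- 1) 1 G 0"
    by (intro Delta_injective_on_empty) simp_all
  then have "agr (- 1) 0 (cube G) (cube 0)"
    by (rule cube_agree) simp
  with F have "F {} {} = delta (C {}) {}"
    by (simp add: agree_def simplices_empty index_sets_def cube_diff_zero Delta_def)
  then show "F {} {} = 0"
    by (simp add: delta_def)
next
  assume "F {} {} = 0"
  then have "agr (- 1) 0 (F - cube 0) (Delta 0)"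
    unfolding agree_def simplices_empty index_sets_def
    by (auto simp: cube_diff_zero Delta_zero dest: finite_subset)
  moreover have "agr 0 0 (Delta F) 0"
    unfolding agree_def by (auto simp: simplices_vertex index_sets_def dest: finite_subset)
  moreover have "agr 0 1 (Delta 0) 0"
    by (simp add: Delta_zero agree_def)
  ultimately show "F \<in> double_coboundaries m K (- 1) 0"
    unfolding double_coboundaries_iff by auto
qed

lemma HH_bottom_iso: "HH m K 0 0 \<cong> integer_group"
proof (rule HH_isoI[where p = "- 1" and T = UNIV and \<theta> = "\<lambda>F. F" and \<Phi> = "\<lambda>F. F {} {}"])
  show "F \<in> double_cocycles m K (- 1) 0" for F
    unfolding double_cocycles_iff agree_def
    by (auto simp: simplices_vertex index_sets_def dest: finite_subset)
  show "\<exists>x\<in>UNIV. z - x \<in> double_coboundaries m K (- 1) 0" for z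
    using zero_coboundary by (intro bexI[of _ z]) auto
  show "\<exists>x\<in>UNIV. x {} {} = (1 :: int)"
    by (intro bexI[of _ "\<lambda>I J. 1"]) auto
qed (simp_all add: bottom_coboundary)

text \<open>The groups themselves vanish here; this is \<open>H~\<^sup>-\<^sup>1(K\<^sub>I) = 0\<close> for nonempty \<open>I\<close>.\<close>
lemma HH_bottom_trivial:
  assumes "l \<noteq> 0" "l - k - 1 = - 1"
  shows "trivial_group (HH m K k l)"
proof (rule HH_trivialI, unfold assms(2), rule subsetI)
  fix F assume "F \<in> double_cocycles m K (- 1) l"
  then have F: "agr 0 l (Delta F) 0"
    by (simp add: double_cocycles_iff)
  then have "agr 0 l (Delta F) (Delta 0)"
    by (simp add: Delta_zero)
  then have "agr (- 1) l F 0"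
    using assms(1) by (rule Delta_injective_on_empty[rotated])
  then have "agr (- 1) l (F - cube 0) (Delta 0)"
    by (simp add: Delta_zero cube_diff_zero)
  moreover have "agr 0 (l + 1) (Delta 0) 0"
    by (simp add: Delta_zero agree_def)
  ultimately show "F \<in> double_coboundaries m K (- 1) l"
    using F unfolding double_coboundaries_iff by auto
qed

lemma agree_two: "agr 2 l F G"
  by (simp add: agree_def simplices_other)

lemma HH_edge_trivial:
  assumes "l \<noteq> int m" "l - k - 1 = 1"
  shows "trivial_group (HH m K k l)"
proof (rule HH_trivialI, unfold assms(2), rule subsetI)
  fix F
  obtain C where "agr 1 l F (Delta C)"
    using proper_edge_exact[OF assms(1)] by blast
  then have "agr 1 l (F - cube 0) (Delta C)"
    by (simp add: cube_diff_zero)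
  then show "F \<in> double_coboundaries m K 1 l"
    unfolding double_coboundaries_iff using agree_two by auto
qed

lemma cube_top: "cube F {1..m} = 0"
  by (simp add: cube_diff_def fun_eq_iff)

lemma top_exact_iff: "winding (E {1..m}) = 0 \<longleftrightarrow> (\<exists>C. agr 1 (int m) E (Delta C))"
proof
  assume "winding (E {1..m}) = 0"
  from winding_zero_exact[OF this] obtain f where "\<forall>i<m. E {1..m} (edge i) = delta f (edge i)"
    by blast
  then have "agr 1 (int m) E (Delta (\<lambda>I. f))"
    by (intro agree_topI) (simp add: Delta_def)
  then show "\<exists>C. agr 1 (int m) E (Delta C)"
    by blast
next
  assume "\<exists>C. agr 1 (int m) E (Delta C)"
  then obtain C where "agr 1 (int m) E (Delta C)"
    by blast
  then show "winding (E {1..m}) = 0"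
    using agree_top_winding[of E "Delta C"] by (simp add: Delta_def winding_delta)
qed

lemma winding_onto: "\<exists>E. winding (E {1..m}) = 1"
  using winding_edge_unit[of 0 "orientation 0"] m
  by (intro exI[of _ "\<lambda>I J. if J = edge 0 then orientation 0 else 0"])
    (simp add: orientation_square)

text \<open>No index set is larger than \<open>[m]\<close>, so \<open>cube G\<close> is zero there and only simplicial coboundaries
  are divided out.\<close>
lemma top_coboundary:
  "F \<in> double_coboundaries m K 1 (int m) \<longleftrightarrow> winding (F {1..m}) = 0"
proof
  assume "F \<in> double_coboundaries m K 1 (int m)"
  then obtain G C where "agr 1 (int m) (F - cube G) (Delta C)"
    by (auto simp: double_coboundaries_iff)
  then have "winding ((F - cube G) {1..m}) = 0"
    using top_exact_iff by blast
  then show "winding (F {1..m}) = 0"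
    by (simp add: cube_top del: One_nat_def)
next
  assume "winding (F {1..m}) = 0"
  then obtain C where "agr 1 (int m) F (Delta C)"
    using top_exact_iff by blast
  then have "agr 1 (int m) (F - cube 0) (Delta C)"
    by (simp add: cube_diff_zero)
  then show "F \<in> double_coboundaries m K 1 (int m)"
    unfolding double_coboundaries_iff using agree_two by auto
qed

lemma HH_top_iso: "HH m K (int m - 2) (int m) \<cong> integer_group"
proof (rule HH_isoI[where p = 1 and T = UNIV and \<theta> = "\<lambda>F. F" and \<Phi> = "\<lambda>F. winding (F {1..m})"])
  show "F \<in> double_cocycles m K 1 (int m)" for F
    unfolding double_cocycles_iff using agree_two proper_edge_exact[of "int m - 1" "cube F"] by auto
  show "\<exists>x\<in>UNIV. z - x \<in> double_coboundaries m K 1 (int m)" for z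
    using zero_coboundary by (intro bexI[of _ z]) auto
  show "\<exists>x\<in>UNIV. winding (x {1..m}) = 1"
    using winding_onto by auto
qed (simp_all add: top_coboundary winding_add)

section \<open>The row of the vertices\<close>
lemma HH_vertex_trivial:
  assumes "l \<noteq> 2" "l \<noteq> int m - 2" "l - k - 1 = 0"
  shows "trivial_group (HH m K k l)"
proof (rule HH_trivialI, unfold assms(3), rule subsetI)
  fix F assume "F \<in> double_cocycles m K 0 l"
  then obtain C where "agr 1 l (Delta F) 0" "agr 0 (l - 1) (cube F) (Delta C)"
    by (auto simp: double_cocycles_iff)
  then show "F \<in> double_coboundaries m K 0 l"
    using closed_on_empty assms(1,2) by (intro coboundary_if_descends)
qed

lemma agree_bottom: "agr (- 1) 0 F G \<longleftrightarrow> F {} {} = G {} {}"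
proof -
  have "index_sets m 0 = {{}}"
    by (auto simp: index_sets_def dest: finite_subset)
  then show ?thesis
    by (simp add: agree_def simplices_empty)
qed

text \<open>A point has no reduced cohomology in degree \<open>0\<close>: a function of its only vertex is the coboundary
  of the same value at the empty simplex.\<close>
lemma Delta_singletons: "agr 0 1 F (Delta (\<lambda>I J. F I I))"
  unfolding agree_def
proof (intro ballI)
  fix I J assume "I \<in> index_sets m 1" "J \<in> simplices (full_subcomplex K I) 0"
  then obtain a where "J = {a}" "I = {a}"
    by (auto simp: index_sets_def simplices_vertex card_1_singleton_iff)
  then show "F I J = Delta (\<lambda>I J. F I I) I J"
    by (simp add: Delta_def delta_vertex)
qed

lemma bottom_value_unique:
  assumes "agr 0 1 (Delta C) (Delta C')"
  shows "cube C {} {} = cube C' {} {}"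
proof -
  have "agr (- 1) 1 C C'"
    using assms by (intro Delta_injective_on_empty) simp_all
  then have "agr (- 1) 0 (cube C) (cube C')"
    by (rule cube_agree) simp
  then show ?thesis
    by (simp add: agree_bottom)
qed

text \<open>The transgression from \<open>(p, l) = (0, 2)\<close> to \<open>(-1, 0)\<close>: the value of \<open>cube C\<close> for any \<open>C\<close> with
  \<open>cube F = Delta C\<close>. Choosing \<open>C\<close> as in \<open>Delta_singletons\<close> makes it additive by its form.\<close>
definition pair_transgression :: "(nat set \<Rightarrow> nat set \<Rightarrow> int) \<Rightarrow> int"
  where "pair_transgression F = cube (\<lambda>I J. cube F I I) {} {}"

lemma pair_transgression_eq:
  assumes "agr 0 1 (cube F) (Delta C)"
  shows "pair_transgression F = cube C {} {}"
  unfolding pair_transgression_def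
  using agree_trans[OF agree_sym[OF Delta_singletons] assms] by (rule bottom_value_unique)

lemma pair_transgression_add:
  "pair_transgression (F + G) = pair_transgression F + pair_transgression G"
  by (simp add: pair_transgression_def cube_diff_def distrib_left sum.distrib)

lemma pair_coboundary:
  assumes "F \<in> double_cocycles m K 0 2"
  shows "F \<in> double_coboundaries m K 0 2 \<longleftrightarrow> pair_transgression F = 0"
proof
  assume "F \<in> double_coboundaries m K 0 2"
  then obtain G C where "agr 0 2 (F - cube G) (Delta C)"
    by (auto simp: double_coboundaries_iff)
  then have "agr 0 1 (cube (F - cube G)) (cube (Delta C))"
    by (rule cube_agree) simp
  then have "agr 0 1 (cube F) (Delta (cube C))"
    using cube_cube[of 0 1 G] by (simp add: agree_def cube_diff_diff Delta_cube_diff)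
  then have "pair_transgression F = cube (cube C) {} {}"
    by (rule pair_transgression_eq)
  then show "pair_transgression F = 0"
    by (simp add: cube_diff_cube_diff)
next
  assume "pair_transgression F = 0"
  then have "agr (- 1) (2 - 2) (cube (\<lambda>I J. cube F I I)) 0"
    by (simp add: agree_bottom pair_transgression_def)
  moreover have "agr 1 2 (Delta F) 0"
    using assms by (simp add: double_cocycles_iff)
  moreover have "agr 0 (2 - 1) (cube F) (Delta (\<lambda>I J. cube F I I))"
    using Delta_singletons[of "cube F"] by simp
  ultimately show "F \<in> double_coboundaries m K 0 2"
    using m by (intro coboundary_if_descends) simp_all
qed

text \<open>The chase backwards: a function \<open>C\<close> on the singletons with \<open>cube C = 1\<close> at the empty set; its
  coboundary is \<open>cube F\<close> since nothing lies below, and \<open>F\<close> can be corrected to a family of cocycles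
  as three vertices do not yet span the whole polygon.\<close>
lemma pair_transgression_onto: "\<exists>F\<in>double_cocycles m K 0 2. pair_transgression F = 1"
proof -
  define C :: "nat set \<Rightarrow> nat set \<Rightarrow> int" where "C = (\<lambda>I J. if I = {1} then 1 else 0)"
  have C1: "cube C {} {} = 1"
  proof -
    have "cube C {} {} = (\<Sum>i\<in>{1..m}. if i = 1 then eps 1 {1} else 0)"
      unfolding cube_diff_def C_def by (intro sum.cong) auto
    also have "\<dots> = eps 1 {1}"
      using m by simp
    also have "\<dots> = 1"
    proof -
      have "{r \<in> {1}. r < (1::nat)} = {}" by auto
      then show ?thesis unfolding eps_def by (simp only: card.empty power_0)
    qed
    finally show ?thesis .
  qed
  define F where "F = homotopy (Delta C)"
  have "agr 0 (1 - 1) (cube (Delta C)) 0"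
    by (auto simp: agree_def simplices_vertex index_sets_def dest: finite_subset)
  then have F: "agr 0 1 (Delta C) (cube F)"
    unfolding F_def by (rule row_exact)
  then have "agr 1 1 (Delta (Delta C)) (cube (Delta F))"
    unfolding Delta_cube_diff[symmetric] by (rule Delta_agree) simp
  then have "agr 1 (2 - 1) (cube (Delta F)) 0"
    using Delta_Delta[of 1 1 C] by (simp add: agree_def)
  then obtain G where G: "agr 1 2 (Delta (F - cube G)) 0"
    using correct_below_top[of 2 F] m by auto
  have C: "agr 0 1 (cube (F - cube G)) (Delta C)"
    using F cube_cube[of 0 1 G] by (simp add: agree_def cube_diff_diff)
  have "F - cube G \<in> double_cocycles m K 0 2"
    using G C by (auto simp: double_cocycles_iff)
  moreover have "pair_transgression (F - cube G) = 1"
    using pair_transgression_eq[OF C] C1 by simp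
  ultimately show ?thesis by blast
qed

lemma HH_pair_iso: "HH m K 1 2 \<cong> integer_group"
proof -
  obtain q where "presented_group (double_cocycles m K 0 2) (double_coboundaries m K 0 2) q (HH m K 1 2)"
    using presented_group_HH[OF face_closed, of 0 2 1] by auto
  then interpret presented_group "double_cocycles m K 0 2" "double_coboundaries m K 0 2" q "HH m K 1 2" .
  show ?thesis
  proof (rule iso_integer_groupI[where T = "double_cocycles m K 0 2" and \<theta> = "\<lambda>F. F"
        and \<Phi> = pair_transgression])
    show "\<exists>x\<in>double_cocycles m K 0 2. z - x \<in> double_coboundaries m K 0 2"
      if "z \<in> double_cocycles m K 0 2" for z
      using that zero_coboundary by (intro bexI[of _ z]) auto
  qed (use zero diff pair_transgression_add pair_transgression_onto pair_coboundary in auto)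
qed

text \<open>The domain of the parametrization of the classes at \<open>(0, m - 2)\<close>: families \<open>G\<close> one level higher
  for which \<open>cube G\<close> consists of cocycles. By \<open>descend\<close> every class is represented by such a
  \<open>cube G\<close>.\<close>
definition liftable :: "(nat set \<Rightarrow> nat set \<Rightarrow> int) set"
  where "liftable = {G. agr 1 (int m - 2) (cube (Delta G)) 0}"

text \<open>The inverse of the transgression from \<open>(1, m)\<close> to \<open>(0, m - 2)\<close>: the unique cochain \<open>E\<close> on the
  edges of the polygon with \<open>cube E = Delta G\<close>, taken modulo coboundaries.\<close>
definition top_transgression :: "(nat set \<Rightarrow> nat set \<Rightarrow> int) \<Rightarrow> int"
  where "top_transgression G = winding (homotopy (Delta G) {1..m})"

lemma top_transgression_add:
  "top_transgression (F + G) = top_transgression F + top_transgression G"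
  by (simp add: top_transgression_def Delta_add cube_homotopy_add winding_add)

lemma liftable_lift:
  assumes "G \<in> liftable"
  shows "agr 1 (int m - 1) (Delta G) (cube (homotopy (Delta G)))"
  using assms by (intro row_exact) (simp add: liftable_def)

text \<open>The difference is closed, hence \<open>cube\<close> of a family on larger index sets, and there are none
  beyond \<open>[m]\<close>.\<close>
lemma cube_injective_at_top:
  assumes "agr 1 (int m - 1) (cube E) (cube E')"
  shows "agr 1 (int m) E E'"
proof -
  have "agr 1 (int m - 1) (cube (E - E')) 0"
    using assms by (simp add: cube_diff_diff agree_minus_iff)
  then have "agr 1 (int m) (E - E') (cube (homotopy (E - E')))"
    by (rule row_exact)
  then have "agr 1 (int m) (E - E') 0"
    by (simp add: agree_def top_index_sets cube_top del: One_nat_def)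
  then show ?thesis
    by (simp add: agree_minus_iff)
qed

lemma liftable_cocycle:
  assumes "G \<in> liftable"
  shows "cube G \<in> double_cocycles m K 0 (int m - 2)"
proof -
  have "agr 0 (int m - 2 - 1) (cube (cube G)) (Delta 0)"
    using cube_cube by (simp add: Delta_zero)
  moreover have "agr 1 (int m - 2) (Delta (cube G)) 0"
    using assms by (simp add: liftable_def Delta_cube_diff)
  ultimately show ?thesis
    unfolding double_cocycles_iff by auto
qed

lemma liftable_onto:
  assumes F: "F \<in> double_cocycles m K 0 (int m - 2)"
  shows "\<exists>G\<in>liftable. F - cube G \<in> double_coboundaries m K 0 (int m - 2)"
proof -
  obtain C where F1: "agr 1 (int m - 2) (Delta F) 0"
    and C: "agr 0 (int m - 2 - 1) (cube F) (Delta C)"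
    using F by (auto simp: double_cocycles_iff)
  have "agr (- 1) (int m - 2 - 2) (cube C) 0"
    using C m by (intro closed_on_empty) simp_all
  then obtain C' G where G: "agr 0 (int m - 2) (F - Delta C') (cube G)"
    "agr 1 (int m - 2) (cube (Delta G)) 0"
    using descend[OF F1 C] by blast
  have "agr 0 (int m - 2) (F - cube G - cube 0) (Delta C')"
    using G(1) by (simp add: agree_def cube_diff_zero algebra_simps)
  moreover have "agr 1 (int m - 2) (Delta (F - cube G)) 0"
    using F1 G(2) by (simp add: Delta_diff Delta_cube_diff agree_def)
  moreover have "agr 1 (int m - 2 + 1) (Delta 0) 0"
    by (simp add: Delta_zero agree_def)
  ultimately have "F - cube G \<in> double_coboundaries m K 0 (int m - 2)"
    unfolding double_coboundaries_iff by auto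
  then show ?thesis
    using G(2) by (auto simp: liftable_def)
qed

lemma top_transgression_onto: "\<exists>G\<in>liftable. top_transgression G = 1"
proof -
  obtain E where E: "winding (E {1..m}) = 1"
    using winding_onto by blast
  obtain G where G: "agr 1 (int m - 1) (cube E) (Delta G)"
    using proper_edge_exact[of "int m - 1" "cube E"] by auto
  then have "agr 1 (int m - 2) (cube (cube E)) (cube (Delta G))"
    by (rule cube_agree) simp
  then have lift: "G \<in> liftable"
    using cube_cube[of 1 "int m - 2" E] by (simp add: liftable_def agree_def)
  have "agr 1 (int m) E (homotopy (Delta G))"
    using agree_trans[OF G liftable_lift[OF lift]] by (rule cube_injective_at_top)
  then have "top_transgression G = 1"
    using agree_top_winding E by (simp add: top_transgression_def)
  with lift show ?thesis by blast
qed

text \<open>If the winding of \<open>E\<close> vanishes, \<open>correct_by_lift\<close> turns \<open>G\<close> into a family of cocycles with the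
  same \<open>cube G\<close>. Conversely, if \<open>cube G\<close> is \<open>cube G\<^sub>0 + Delta C\<close> with cocycles \<open>G\<^sub>0\<close>, then \<open>C\<close> is itself
  in the image of \<open>cube\<close>, so \<open>G\<close> is \<open>G\<^sub>0\<close> up to \<open>Delta\<close> and \<open>cube X\<close> for some \<open>X\<close>; applying \<open>Delta\<close>
  shows that \<open>E = Delta X\<close>.\<close>
lemma liftable_coboundary:
  assumes G: "G \<in> liftable"
  shows "cube G \<in> double_coboundaries m K 0 (int m - 2) \<longleftrightarrow> top_transgression G = 0"
proof
  assume "top_transgression G = 0"
  then obtain C where C: "agr 1 (int m - 1 + 1) (homotopy (Delta G)) (Delta C)"
    using top_exact_iff[of "homotopy (Delta G)"] by (auto simp: top_transgression_def)
  have "agr 1 (int m - 2 + 1) (Delta (G - cube C)) 0"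
    using correct_by_lift[OF liftable_lift[OF G] C] by simp
  moreover have "agr 0 (int m - 2) (cube G - cube (G - cube C)) (Delta 0)"
    using cube_cube[of 0 "int m - 2" C] by (simp add: cube_diff_diff Delta_zero)
  moreover have "agr 1 (int m - 2) (Delta (cube G)) 0"
    using G by (simp add: liftable_def Delta_cube_diff)
  ultimately show "cube G \<in> double_coboundaries m K 0 (int m - 2)"
    unfolding double_coboundaries_iff by auto
next
  assume "cube G \<in> double_coboundaries m K 0 (int m - 2)"
  then obtain G0 C where G0: "agr 1 (int m - 1) (Delta G0) 0"
    and C: "agr 0 (int m - 2) (cube G - cube G0) (Delta C)"
    by (auto simp: double_coboundaries_iff)
  then have C1: "agr 0 (int m - 1 - 1) (cube (G - G0)) (Delta C)"
    by (simp add: cube_diff_diff)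
  then have "agr (- 1) (int m - 1 - 2) (cube C) 0"
    using m by (intro closed_on_empty) simp_all
  then have "agr (- 1) (int m - 2) C (cube (homotopy C))"
    by (intro row_exact) simp
  then have "agr 0 (int m - 2) (Delta C) (Delta (cube (homotopy C)))"
    by (rule Delta_agree) simp
  with C have "agr 0 (int m - 1 - 1) (cube (G - G0 - Delta (homotopy C))) 0"
    by (simp add: cube_diff_diff Delta_cube_diff agree_def)
  from Delta_agree[OF row_exact[OF this], of 1]
  obtain X where X: "agr 1 (int m - 1) (Delta (G - G0 - Delta (homotopy C))) (cube (Delta X))"
    by (auto simp: Delta_cube_diff)
  have "agr 1 (int m - 1) (Delta G) (cube (Delta X))"
    using X G0 Delta_Delta[of 1 "int m - 1" "homotopy C"] by (simp add: Delta_diff agree_def)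
  then have "agr 1 (int m) (homotopy (Delta G)) (Delta X)"
    using liftable_lift[OF G] agree_sym agree_trans by (blast intro: cube_injective_at_top)
  then show "top_transgression G = 0"
    unfolding top_transgression_def using top_exact_iff by blast
qed

lemma HH_subtop_iso: "HH m K (int m - 3) (int m - 2) \<cong> integer_group"
proof (rule HH_isoI[where p = 0 and T = liftable and \<theta> = cube and \<Phi> = top_transgression])
  show "0 \<in> liftable"
    by (simp add: liftable_def Delta_zero cube_diff_zero agree_def)
  show "F - G \<in> liftable" if "F \<in> liftable" "G \<in> liftable" for F G
    using that by (simp add: liftable_def Delta_diff cube_diff_diff agree_def)
qed (simp_all add: liftable_cocycle liftable_onto liftable_coboundary cube_diff_add
    top_transgression_add top_transgression_onto)

end

theorem theorem7p2:
  fixes m :: nat and L :: "nat set set" and k l :: int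
  assumes "m \<ge> 5" and "cycle_complex m L"
  shows "if (- k, 2 * l) \<in> {(0, 0), (- 1, 4), (- int m + 3, 2 * (int m - 2)), (- int m + 2, 2 * int m)}
         then HH m L k l \<cong> integer_group
         else trivial_group (HH m L k l)"
proof -
  obtain v where "bij_betw v {..<m} {1..m}"
    "L = {{}} \<union> {{v i} | i. i < m} \<union> {{v i, v (Suc i mod m)} | i. i < m}"
    using assms(2) unfolding cycle_complex_def by blast
  then interpret polygon m L v
    using assms(1) by unfold_locales
  let ?D = "{(0, 0), (1, 2), (int m - 3, int m - 2), (int m - 2, int m)}"
  have iff: "(- k, 2 * l) \<in> {(0, 0), (- 1, 4), (- int m + 3, 2 * (int m - 2)), (- int m + 2, 2 * int m)}
      \<longleftrightarrow> (k, l) \<in> ?D"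
    by auto
  have "HH m L k l \<cong> integer_group" if "(k, l) \<in> ?D"
    using that HH_bottom_iso HH_pair_iso HH_subtop_iso HH_top_iso by auto
  moreover have "trivial_group (HH m L k l)" if "(k, l) \<notin> ?D"
  proof -
    consider "l - k - 1 = - 1" | "l - k - 1 = 0" | "l - k - 1 = 1"
      | "l - k - 1 \<noteq> - 1" "l - k - 1 \<noteq> 0" "l - k - 1 \<noteq> 1"
      by blast
    then show ?thesis
    proof cases
      case 1
      then have "l \<noteq> 0" using that by auto
      then show ?thesis using 1 by (rule HH_bottom_trivial)
    next
      case 2
      then have "l \<noteq> 2" "l \<noteq> int m - 2" using that by auto
      then show ?thesis using 2 by (rule HH_vertex_trivial)
    next
      case 3
      then have "l \<noteq> int m" using that by auto
      then show ?thesis using 3 by (rule HH_edge_trivial)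
    next
      case 4
      then show ?thesis by (rule HH_other_degree)
    qed
  qed
  ultimately show ?thesis
    unfolding iff by (cases "(k, l) \<in> ?D") (simp_all only: if_True if_False simp_thms)
qed

end
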